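(* Let $A=[\mathbf a_1,\dots,\mathbf a_m]^\top\in\mathbb{R}^{m\times p}$, $B=[\mathbf b_1,\dots,\mathbf b_m]^\top\in\mathbb{R}^{m\times n}$, $\mathbf c=(c_1,\dots,c_m)\in\mathbb{R}^m$, $\mathbf d\in\mathbb{R}^p$ and $\lambda\ge 0$ be given, such that $\{(\boldsymbol\xi,\boldsymbol\theta)\in\mathbb{R}^{p+n}: A\boldsymbol\xi+B\boldsymbol\theta\le\mathbf c\}$ is nonempty. If $\lambda=0$, suppose in addition that $-\mathbf d=A^\top\mathbf u$ for some $\mathbf u\in\mathbb{R}^m$ with $\mathbf u\ge\mathbf 0$. For any $\mathbf y\in\mathbb{R}^n$, let $(\hat{\boldsymbol\theta}(\mathbf y),\hat{\boldsymbol\xi}(\mathbf y))$ be any solution of $$\min_{\boldsymbol\theta\in\mathbb{R}^n,\ \boldsymbol\xi\in\mathbb{R}^p}\ \tfrac12\|\boldsymbol\theta-\mathbf y\|_2^2+\mathbf d^\top\boldsymbol\xi+\tfrac{\lambda}{2}\|\boldsymbol\xi\|_2^2\quad\text{s.t.}\quad A\boldsymbol\xi+B\boldsymbol\theta\le\mathbf c, \qquad (\ast)$$ let $J_{\mathbf y}:=\{1\le i\le m:\langle\mathbf a_i,\hat{\boldsymbol\xi}(\mathbf y)\rangle+\langle\mathbf b_i,\hat{\boldsymbol\theta}(\mathbf y)\rangle=c_i\}$, and let $I_{\mathbf y}\subseteq J_{\mathbf y}$ be an index set of a maximal set of linearly independent rows of the matrix $[A_{J_{\mathbf y}},B_{J_{\mathbf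 y}}]$ (so the vectors $[\mathbf a_i^\top,\mathbf b_i^\top]$, $i\in I_{\mathbf y}$, are linearly independent). Then: (i) The component $\hat{\boldsymbol\theta}(\mathbf y)$ of the optimal solution of $(\ast)$ is unique. The components $\hat\theta_i(\mathbf y)$ of $\hat{\boldsymbol\theta}(\mathbf y)$ are almost differentiable in $\mathbf y$, and $\nabla\hat\theta_i(\mathbf y)$ is an essentially bounded function for each $i=1,\dots,n$. (ii) For almost every $\mathbf y\in\mathbb{R}^n$, $$D(\mathbf y)=\begin{cases} n-\mathrm{trace}\Big(B_{I_{\mathbf y}}^\top\big(B_{I_{\mathbf y}}B_{I_{\mathbf y}}^\top+\tfrac1\lambda A_{I_{\mathbf y}}A_{I_{\mathbf y}}^\top\big)^{-1}B_{I_{\mathbf y}}\Big), & \text{if }\lambda>0,\\[4pt] n-|I_{\mathbf y}|+\mathrm{rank}(A_{I_{\mathbf y}}), & \text{if }\lambda=0,\end{cases}$$ and $\mathrm{df}(\hat{\boldsymbol\theta}(\mathbf y))=\mathbb{E}[D(\mathbf y)]$.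
   Context: Inequalities between vectors are componentwise. For an index set $J\subseteq\{1,\dots,m\}$, $A_J$, $B_J$ denote the submatrices of $A$, $B$ consisting of the rows indexed by $J$. The divergence of $\hat{\boldsymbol\theta}$ is $D(\mathbf y):=\sum_{i=1}^n\frac{\partial}{\partial y_i}\hat\theta_i(\mathbf y)$. For the statement about degrees of freedom, $\mathbf y=\boldsymbol\theta^*+\boldsymbol\epsilon$ with $\boldsymbol\theta^*\in\mathbb{R}^n$ fixed and $\boldsymbol\epsilon\sim N(\mathbf 0,\sigma^2 I_n)$, $\sigma>0$, and $\mathrm{df}(\hat{\boldsymbol\theta}(\mathbf y)):=\frac{1}{\sigma^2}\sum_{i=1}^n\mathrm{Cov}(\hat\theta_i(\mathbf y),y_i)$. A function $f:\mathbb{R}^n\to\mathbb{R}$ is called almost differentiable here if it is differentiable everywhere except on a set of Lebesgue measure zero. A function is essentially bounded if its absolute value (norm) is bounded by a constant outside a set of Lebesgue measure zero. "Almost every" refers to Lebesgue measure on $\mathbb{R}^n$. *)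

theory Defs
  imports "HOL-Analysis.Analysis" "HOL-Probability.Probability"
begin

subsection \<open>The quadratic program\<close>

definition qp_objective ::
  "real^'p \<Rightarrow> real \<Rightarrow> real^'n \<Rightarrow> real^'n \<Rightarrow> real^'p \<Rightarrow> real"
  where "qp_objective d lam y \<theta> \<xi> =
    1/2 * (norm (\<theta> - y))\<^sup>2 + d \<bullet> \<xi> + lam/2 * (norm \<xi>)\<^sup>2"

text \<open>The order on vectors is the componentwise one.\<close>

definition qp_solution ::
  "real^'p^'m \<Rightarrow> real^'n^'m \<Rightarrow> real^'m \<Rightarrow> real^'p \<Rightarrow> real \<Rightarrow> real^'n \<Rightarrow> real^'n \<Rightarrow> real^'p \<Rightarrow> bool"
  where "qp_solution A B c d lam y \<theta> \<xi> \<longleftrightarrow>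
    is_arg_min (\<lambda>(\<theta>, \<xi>). qp_objective d lam y \<theta> \<xi>)
      (\<lambda>(\<theta>, \<xi>). A *v \<xi> + B *v \<theta> \<le> c) (\<theta>, \<xi>)"

definition tight_rows ::
  "real^'p^'m \<Rightarrow> real^'n^'m \<Rightarrow> real^'m \<Rightarrow> real^'n \<Rightarrow> real^'p \<Rightarrow> 'm set"
  where "tight_rows A B c \<theta> \<xi> = {i. A $ i \<bullet> \<xi> + B $ i \<bullet> \<theta> = c $ i}"

text \<open>
  The \<open>i\<close>-th row of the block matrix \<open>[A, B]\<close> is the pair \<open>(A $ i, B $ i)\<close>.  Injectivity makes
  this independence of an indexed family: two equal rows are dependent.
\<close>

definition indep_rows :: "real^'p^'m \<Rightarrow> real^'n^'m \<Rightarrow> 'm set \<Rightarrow> bool"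
  where "indep_rows A B I \<longleftrightarrow>
    inj_on (\<lambda>i. (A $ i, B $ i)) I \<and> independent ((\<lambda>i. (A $ i, B $ i)) ` I)"

definition maximal_indep_rows :: "real^'p^'m \<Rightarrow> real^'n^'m \<Rightarrow> 'm set \<Rightarrow> 'm set \<Rightarrow> bool"
  where "maximal_indep_rows A B J I \<longleftrightarrow>
    I \<subseteq> J \<and> indep_rows A B I \<and> (\<forall>I'. I \<subseteq> I' \<and> I' \<subseteq> J \<and> indep_rows A B I' \<longrightarrow> I' = I)"


subsection \<open>Row submatrices\<close>

text \<open>
  The size of a row submatrix \<open>A\<^sub>I\<close> varies with \<open>I\<close>, while matrix dimensions are types.  So \<open>A\<^sub>I\<close> is
  stored in the format of \<open>A\<close> with the rows outside \<open>I\<close> set to zero.  An \<open>I \<times> I\<close> matrix then is a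
  matrix vanishing outside \<open>I \<times> I\<close>; these are closed under sums and products, with the unit
  \<open>block_mat1 I\<close>, and \<open>block_inv I\<close> is the inverse among them.  Zero padding changes neither
  ranks, nor products, nor traces.
\<close>

definition row_submatrix :: "'m set \<Rightarrow> real^'k^'m \<Rightarrow> real^'k^'m"
  where "row_submatrix I A = (\<chi> i j. if i \<in> I then A $ i $ j else 0)"

definition block_mat1 :: "'m set \<Rightarrow> real^'m^'m"
  where "block_mat1 I = (\<chi> i j. if i = j \<and> i \<in> I then 1 else 0)"

definition is_block_inv :: "'m set \<Rightarrow> real^'m^'m \<Rightarrow> real^'m^'m \<Rightarrow> bool"
  where "is_block_inv I M X \<longleftrightarrow>
    (\<forall>i j. i \<notin> I \<or> j \<notin> I \<longrightarrow> X $ i $ j = 0) \<and>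
    M ** X = block_mat1 I \<and> X ** M = block_mat1 I"

definition block_inv :: "'m set \<Rightarrow> real^'m^'m \<Rightarrow> real^'m^'m"
  where "block_inv I M = (SOME X. is_block_inv I M X)"

lemma block_mat1_mult:
  assumes "\<forall>i j. i \<notin> I \<or> j \<notin> I \<longrightarrow> X $ i $ j = 0"
  shows "block_mat1 I ** X = X" and "X ** block_mat1 I = X"
proof -
  have "block_mat1 I $ i $ k * X $ k $ j = (if k = i then X $ i $ j else 0)"
    "X $ i $ k * block_mat1 I $ k $ j = (if k = j then X $ i $ j else 0)" for i j k
    using assms by (auto simp: block_mat1_def)
  then show "block_mat1 I ** X = X" "X ** block_mat1 I = X"
    by (simp_all add: vec_eq_iff matrix_matrix_mult_def)
qed

lemma block_inv_eqI:
  assumes "is_block_inv I M X"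
  shows "block_inv I M = X"
proof -
  have "Y = X" if "is_block_inv I M Y" for Y
    using that assms block_mat1_mult[of I X] block_mat1_mult[of I Y]
    unfolding is_block_inv_def by (metis matrix_mul_assoc)
  then show ?thesis
    unfolding block_inv_def using assms by (metis someI_ex)
qed

lemma block_inv_UNIV: "block_inv UNIV M = matrix_inv M"
  by (simp add: block_inv_def is_block_inv_def matrix_inv_def block_mat1_def mat_def)


subsection \<open>Derivatives almost everywhere\<close>

definition partial_deriv :: "'n \<Rightarrow> (real^'n \<Rightarrow> real) \<Rightarrow> real^'n \<Rightarrow> real"
  where "partial_deriv i f y = deriv (\<lambda>t. f (y + t *\<^sub>R axis i 1)) 0"

definition gradient :: "(real^'n \<Rightarrow> real) \<Rightarrow> real^'n \<Rightarrow> real^'n"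
  where "gradient f y = (\<chi> j. partial_deriv j f y)"

definition divergence :: "(real^'n \<Rightarrow> real^'n) \<Rightarrow> real^'n \<Rightarrow> real"
  where "divergence F y = (\<Sum>i\<in>UNIV. partial_deriv i (\<lambda>z. F z $ i) y)"

definition almost_differentiable :: "(real^'n \<Rightarrow> real) \<Rightarrow> bool"
  where "almost_differentiable f \<longleftrightarrow> (AE y in lebesgue. f differentiable (at y))"

definition essentially_bounded :: "(real^'n \<Rightarrow> 'b::real_normed_vector) \<Rightarrow> bool"
  where "essentially_bounded g \<longleftrightarrow> (\<exists>C. AE y in lebesgue. norm (g y) \<le> C)"


subsection \<open>Gaussian noise and degrees of freedom\<close>

text \<open>The density of \<open>N(0, \<sigma>\<^sup>2 I)\<close>; the second argument of \<^const>\<open>normal_density\<close> is the standard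
  deviation.\<close>

definition isotropic_normal_density :: "real \<Rightarrow> real^'n \<Rightarrow> real"
  where "isotropic_normal_density \<sigma> x = (\<Prod>i\<in>UNIV. normal_density 0 \<sigma> (x $ i))"

definition covariance :: "'w measure \<Rightarrow> ('w \<Rightarrow> real) \<Rightarrow> ('w \<Rightarrow> real) \<Rightarrow> real"
  where "covariance M X Y =
    (\<integral>\<omega>. (X \<omega> - (\<integral>\<omega>'. X \<omega>' \<partial>M)) * (Y \<omega> - (\<integral>\<omega>'. Y \<omega>' \<partial>M)) \<partial>M)"

text \<open>Bochner integrals of non-integrable functions are zero by convention; this predicate says
  that all integrals in the covariance are genuine.\<close>

definition has_covariance :: "'w measure \<Rightarrow> ('w \<Rightarrow> real) \<Rightarrow> ('w \<Rightarrow> real) \<Rightarrow> bool"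
  where "has_covariance M X Y \<longleftrightarrow>
    integrable M X \<and> integrable M Y \<and> integrable M (\<lambda>\<omega>. X \<omega> * Y \<omega>)"

definition degrees_of_freedom ::
  "'w measure \<Rightarrow> real \<Rightarrow> ('w \<Rightarrow> real^'n) \<Rightarrow> (real^'n \<Rightarrow> real^'n) \<Rightarrow> real"
  where "degrees_of_freedom M \<sigma> Y F =
    1 / \<sigma>\<^sup>2 * (\<Sum>i\<in>UNIV. covariance M (\<lambda>\<omega>. F (Y \<omega>) $ i) (\<lambda>\<omega>. Y \<omega> $ i))"

end

theory Submission
  imports Defs
begin

text \<open>
  The map \<open>y \<mapsto> \<theta>\<close> from the data to the \<open>\<theta>\<close>-part of a minimizer is nonexpansive: add the variational
  inequalities of two minimizers.  This gives uniqueness, continuity, and the bound on the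
  gradients.

  The map is also piecewise affine, with one affine piece for each index set \<open>I\<close>.  Moving from a
  minimizer in a direction that keeps its active constraints active, forwards or backwards, cannot
  decrease the objective, so the gradient \<open>(d + lam \<xi>, \<theta> - y)\<close> lies in the span of the active rows,
  which is the span of the rows in \<open>I\<close>.
  For two data points with the same \<open>I\<close>, denote differences by \<open>\<Delta>\<close>.  Subtracting the two conditions
  yields a vector \<open>v\<close> supported on \<open>I\<close> with
  \<open>A\<^sub>I\<^sup>T v = lam \<Delta>\<xi>\<close>, \<open>B\<^sub>I\<^sup>T v = \<Delta>\<theta> - \<Delta>y\<close>, and \<open>A\<^sub>I \<Delta>\<xi> + B\<^sub>I \<Delta>\<theta> = 0\<close> (\<open>qp_solution_difference\<close>).
  If \<open>lam > 0\<close>, eliminating \<open>\<Delta>\<xi>\<close> leaves \<open>M v = - B\<^sub>I \<Delta>y\<close> with the invertible Gram matrix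
  \<open>M = B\<^sub>I B\<^sub>I\<^sup>T + A\<^sub>I A\<^sub>I\<^sup>T / lam\<close>, so \<open>\<Delta>\<theta> = (1 - B\<^sub>I\<^sup>T M\<inverse> B\<^sub>I) \<Delta>y\<close>.
  If \<open>lam = 0\<close>, the second relation puts \<open>\<Delta>\<theta> - \<Delta>y\<close> into \<open>W = B\<^sub>I\<^sup>T (ker A\<^sub>I\<^sup>T)\<close> and the third makes
  \<open>\<Delta>\<theta>\<close> orthogonal to \<open>W\<close>, so \<open>\<Delta>\<theta>\<close> is the projection of \<open>\<Delta>y\<close> to the orthogonal complement of \<open>W\<close>;
  its trace is \<open>n - dim W\<close>, and \<open>dim W = |I| - rank A\<^sub>I\<close> as the rows are independent.  In both cases the
  trace of the linear map is the asserted divergence.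

  Derivatives follow from these pieces, however irregular the choice of \<open>I\<close> is.  Two distinct affine
  maps agree only on a proper affine subspace, which is a null set; off these finitely many subspaces
  continuity forces the map to follow a single piece near each point (\<open>AE_has_derivative_affine_selection\<close>).

  The statement on degrees of freedom is Stein's identity for Lipschitz functions.  The integral of
  \<open>f (x + t e) \<phi> x\<close> equals that of \<open>f x \<phi> (x - t e)\<close> by translation invariance, and both sides may be
  differentiated at \<open>t = 0\<close> by dominated convergence (\<open>stein_identity\<close>).

  Existence of minimizers is a nearest-point problem for \<open>lam > 0\<close>.  For \<open>lam = 0\<close> the objective need
  not be coercive in \<open>\<xi>\<close>; one minimizes over \<open>\<theta>\<close> and an upper bound \<open>t\<close> for \<open>d \<bullet> \<xi>\<close> instead.  Dual
  feasibility makes this problem coercive, and its domain is closed because finitely generated cones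
  are closed.
\<close>

section \<open>First-order conditions\<close>

lemma qp_objective_along_line:
  "qp_objective d lam y (\<theta> + t *\<^sub>R h) (\<xi> + t *\<^sub>R k) =
    qp_objective d lam y \<theta> \<xi> + t * ((\<theta> - y) \<bullet> h + (d + lam *\<^sub>R \<xi>) \<bullet> k)
      + t\<^sup>2 * ((norm h)\<^sup>2 + lam * (norm k)\<^sup>2) / 2"
proof -
  have *: "\<theta> + t *\<^sub>R h - y = (\<theta> - y) + t *\<^sub>R h" by simp
  show ?thesis
    unfolding qp_objective_def * power2_norm_eq_inner
    by (simp add: inner_simps inner_commute power2_eq_square field_simps)
qed

text \<open>
  Divide the increase of the objective along the direction, a quadratic polynomial in \<open>t\<close> without constant
  term, by \<open>t > 0\<close> and let \<open>t\<close> tend to zero.  Feasibility is stated for small positive steps so that the lemma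
  serves both segments inside the feasible set and directions along active constraints.
\<close>

lemma qp_first_order:
  assumes sol: "qp_solution A B c d lam y \<theta> \<xi>"
    and feas: "\<forall>\<^sub>F t in at_right 0. A *v (\<xi> + t *\<^sub>R k) + B *v (\<theta> + t *\<^sub>R h) \<le> c"
  shows "0 \<le> (\<theta> - y) \<bullet> h + (d + lam *\<^sub>R \<xi>) \<bullet> k" (is "0 \<le> ?g")
proof -
  define q where "q = ((norm h)\<^sup>2 + lam * (norm k)\<^sup>2) / 2"
  have "\<forall>\<^sub>F t in at_right (0::real). 0 \<le> ?g + t * q"
    using feas eventually_at_right_less[of "0::real"]
  proof eventually_elim
    case (elim t)
    have "\<not> qp_objective d lam y (\<theta> + t *\<^sub>R h) (\<xi> + t *\<^sub>R k) < qp_objective d lam y \<theta> \<xi>"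
      using sol elim by (auto simp: qp_solution_def is_arg_min_def)
    hence "0 \<le> t * (?g + t * q)"
      unfolding qp_objective_along_line q_def by (simp add: algebra_simps power2_eq_square)
    thus ?case using elim by (simp add: zero_le_mult_iff)
  qed
  moreover have "((\<lambda>t. ?g + t * q) \<longlongrightarrow> ?g + 0 * q) (at_right 0)"
    by (intro tendsto_intros)
  ultimately show ?thesis
    using tendsto_lowerbound[of "\<lambda>t. ?g + t * q" "?g + 0 * q" "at_right 0" 0] by simp
qed

lemma qp_variational_inequality:
  assumes sol: "qp_solution A B c d lam y \<theta> \<xi>" and feas: "A *v \<xi>' + B *v \<theta>' \<le> c"
  shows "0 \<le> (\<theta> - y) \<bullet> (\<theta>' - \<theta>) + (d + lam *\<^sub>R \<xi>) \<bullet> (\<xi>' - \<xi>)"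
proof (rule qp_first_order[OF sol])
  have f0: "A *v \<xi> + B *v \<theta> \<le> c" using sol by (simp add: qp_solution_def is_arg_min_def)
  have "\<forall>\<^sub>F t in at_right (0::real). t < 1" by (rule eventually_at_right_real[THEN eventually_mono, of 0 1]) auto
  then show "\<forall>\<^sub>F t in at_right 0.
    A *v (\<xi> + t *\<^sub>R (\<xi>' - \<xi>)) + B *v (\<theta> + t *\<^sub>R (\<theta>' - \<theta>)) \<le> c"
    using eventually_at_right_less[of "0::real"]
  proof eventually_elim
    case (elim t)
    have "A *v (\<xi> + t *\<^sub>R (\<xi>' - \<xi>)) + B *v (\<theta> + t *\<^sub>R (\<theta>' - \<theta>))
      = (1 - t) *\<^sub>R (A *v \<xi> + B *v \<theta>) + t *\<^sub>R (A *v \<xi>' + B *v \<theta>')"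
      by (simp add: matrix_vector_mult_scaleR matrix_vector_right_distrib matrix_vector_mult_diff_distrib algebra_simps)
    also have "\<dots> \<le> (1 - t) *\<^sub>R c + t *\<^sub>R c"
      using elim f0 feas by (intro add_mono scaleR_left_mono) auto
    finally show ?case by (simp add: algebra_simps)
  qed
qed

lemma qp_solution_feasible:
  "qp_solution A B c d lam y \<theta> \<xi> \<Longrightarrow> A *v \<xi> + B *v \<theta> \<le> c"
  by (simp add: qp_solution_def is_arg_min_def)

text \<open>
  Each minimizer is feasible for the problem of the other, because the constraints do not involve
  the data.  The sum of the two variational inequalities is the monotonicity argument for proximal maps.
\<close>

lemma qp_solution_nonexpansive:
  assumes "lam \<ge> 0"
    and 1: "qp_solution A B c d lam y1 \<theta>1 \<xi>1" and 2: "qp_solution A B c d lam y2 \<theta>2 \<xi>2"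
  shows "norm (\<theta>1 - \<theta>2) \<le> norm (y1 - y2)"
proof -
  have "0 \<le> (\<theta>1 - y1) \<bullet> (\<theta>2 - \<theta>1) + (d + lam *\<^sub>R \<xi>1) \<bullet> (\<xi>2 - \<xi>1)"
       "0 \<le> (\<theta>2 - y2) \<bullet> (\<theta>1 - \<theta>2) + (d + lam *\<^sub>R \<xi>2) \<bullet> (\<xi>1 - \<xi>2)"
    using qp_variational_inequality[OF 1 qp_solution_feasible[OF 2]]
      qp_variational_inequality[OF 2 qp_solution_feasible[OF 1]] by auto
  hence "0 \<le> (y1 - y2) \<bullet> (\<theta>1 - \<theta>2) - (\<theta>1 - \<theta>2) \<bullet> (\<theta>1 - \<theta>2) - lam * ((\<xi>1 - \<xi>2) \<bullet> (\<xi>1 - \<xi>2))"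
    by (simp add: inner_simps algebra_simps inner_commute)
  moreover have "0 \<le> lam * ((\<xi>1 - \<xi>2) \<bullet> (\<xi>1 - \<xi>2))" using assms by simp
  moreover have "(y1 - y2) \<bullet> (\<theta>1 - \<theta>2) \<le> norm (y1 - y2) * norm (\<theta>1 - \<theta>2)"
    by (rule norm_cauchy_schwarz)
  ultimately have "norm (\<theta>1 - \<theta>2) * norm (\<theta>1 - \<theta>2) \<le> norm (y1 - y2) * norm (\<theta>1 - \<theta>2)"
    by (simp add: dot_square_norm power2_eq_square)
  thus ?thesis by (cases "norm (\<theta>1 - \<theta>2) = 0") auto
qed

lemma in_span_if_orthogonal_to_annihilator:
  fixes g :: "'a::euclidean_space"
  assumes "\<And>z. (\<And>r. r \<in> R \<Longrightarrow> r \<bullet> z = 0) \<Longrightarrow> g \<bullet> z = 0"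
  shows "g \<in> span R"
proof -
  obtain x z where x: "x \<in> span R" and z: "\<And>w. w \<in> span R \<Longrightarrow> orthogonal z w" and g: "g = x + z"
    using orthogonal_subspace_decomp_exists[of R g] by blast
  have "g \<bullet> z = 0"
    using z by (intro assms) (auto simp: orthogonal_def inner_commute span_base)
  moreover have "x \<bullet> z = 0" using z[OF x] by (simp add: orthogonal_def inner_commute)
  ultimately show ?thesis using x g by (simp add: inner_add_left)
qed

text \<open>
  A direction orthogonal to all active rows is feasible for small steps in both orientations, so the gradient is
  orthogonal to it.
\<close>

lemma qp_stationarity:
  fixes A :: "real^'p^'m" and B :: "real^'n^'m"
  assumes sol: "qp_solution A B c d lam y \<theta> \<xi>"
  shows "(d + lam *\<^sub>R \<xi>, \<theta> - y) \<in> span ((\<lambda>i. (A $ i, B $ i)) ` tight_rows A B c \<theta> \<xi>)"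
proof (rule in_span_if_orthogonal_to_annihilator)
  have ineq: "0 \<le> (\<theta> - y) \<bullet> h + (d + lam *\<^sub>R \<xi>) \<bullet> k"
    if z: "\<And>i. i \<in> tight_rows A B c \<theta> \<xi> \<Longrightarrow> A $ i \<bullet> k + B $ i \<bullet> h = 0" for h k
  proof (rule qp_first_order[OF sol])
    have "\<forall>\<^sub>F t in at_right (0::real). A $ i \<bullet> \<xi> + B $ i \<bullet> \<theta> + t * (A $ i \<bullet> k + B $ i \<bullet> h) \<le> c $ i" for i
    \<comment> \<open>Active rows stay active along the direction; the other rows have slack, which survives small steps.\<close>
    proof (cases "i \<in> tight_rows A B c \<theta> \<xi>")
      case True
      then show ?thesis using z[OF True] by (simp add: tight_rows_def)
    next
      case False
      have "A $ i \<bullet> \<xi> + B $ i \<bullet> \<theta> \<le> c $ i"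
        using qp_solution_feasible[OF sol]
        by (simp add: less_eq_vec_def matrix_vector_mult_def inner_vec_def)
      with False have less: "A $ i \<bullet> \<xi> + B $ i \<bullet> \<theta> < c $ i" by (simp add: tight_rows_def)
      have "((\<lambda>t. A $ i \<bullet> \<xi> + B $ i \<bullet> \<theta> + t * (A $ i \<bullet> k + B $ i \<bullet> h)) \<longlongrightarrow>
             A $ i \<bullet> \<xi> + B $ i \<bullet> \<theta> + 0 * (A $ i \<bullet> k + B $ i \<bullet> h)) (at_right (0::real))"
        by (intro tendsto_intros)
      hence "\<forall>\<^sub>F t in at_right (0::real). A $ i \<bullet> \<xi> + B $ i \<bullet> \<theta> + t * (A $ i \<bullet> k + B $ i \<bullet> h) < c $ i"
        by (rule order_tendstoD(2)) (use less in simp)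
      thus ?thesis by eventually_elim simp
    qed
    hence "\<forall>\<^sub>F t in at_right (0::real). \<forall>i. A $ i \<bullet> \<xi> + B $ i \<bullet> \<theta> + t * (A $ i \<bullet> k + B $ i \<bullet> h) \<le> c $ i"
      by (rule eventually_all_finite)
    thus "\<forall>\<^sub>F t in at_right 0. A *v (\<xi> + t *\<^sub>R k) + B *v (\<theta> + t *\<^sub>R h) \<le> c"
      by eventually_elim
        (simp add: less_eq_vec_def matrix_vector_mul_component inner_add_right algebra_simps)
  qed
  fix z :: "(real^'p) \<times> (real^'n)"
  assume z: "\<And>r. r \<in> (\<lambda>i. (A $ i, B $ i)) ` tight_rows A B c \<theta> \<xi> \<Longrightarrow> r \<bullet> z = 0"
  obtain k h where kh: "z = (k, h)" by (cases z)
  have zero: "A $ i \<bullet> k + B $ i \<bullet> h = 0" if "i \<in> tight_rows A B c \<theta> \<xi>" for i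
    using z[of "(A $ i, B $ i)"] that kh by auto
  have zero_neg: "A $ i \<bullet> (- k) + B $ i \<bullet> (- h) = 0" if "i \<in> tight_rows A B c \<theta> \<xi>" for i
    using zero[OF that] unfolding inner_minus_right by linarith
  have "0 \<le> (\<theta> - y) \<bullet> h + (d + lam *\<^sub>R \<xi>) \<bullet> k"
    and "0 \<le> (\<theta> - y) \<bullet> (- h) + (d + lam *\<^sub>R \<xi>) \<bullet> (- k)"
    using ineq[OF zero] ineq[OF zero_neg] by simp_all
  then show "(d + lam *\<^sub>R \<xi>, \<theta> - y) \<bullet> z = 0"
    unfolding kh inner_Pair inner_minus_right by linarith
qed

section \<open>Existence of minimizers\<close>

lemma continuous_on_matrix_vector_mult:
  fixes A :: "real^'n^'m"
  assumes "continuous_on S f"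
  shows "continuous_on S (\<lambda>x. A *v f x)"
  by (rule bounded_linear.continuous_on[OF _ assms]) (simp add: linear_conv_bounded_linear[symmetric])

lemma closed_feasible_set:
  assumes "continuous_on UNIV f"
  shows "closed {x. f x \<le> (c :: real^'m)}"
proof -
  have "closed (f -` {..c})"
    by (intro closed_vimage closed_eucl_atMost assms)
  then show ?thesis by (simp add: vimage_def)
qed

text \<open>
  Completing the square in \<open>\<xi>\<close> and rescaling it by \<open>sqrt lam\<close> turns the objective into half the squared
  distance from \<open>(y, - d / sqrt lam)\<close>, up to a constant.
\<close>

lemma qp_solution_exists_pos:
  fixes A :: "real^'p^'m" and B :: "real^'n^'m"
  assumes lam: "lam > 0" and feas: "{(\<xi>, \<theta>). A *v \<xi> + B *v \<theta> \<le> c} \<noteq> {}"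
  shows "\<exists>\<theta> \<xi>. qp_solution A B c d lam y \<theta> \<xi>"
proof -
  define s where "s = sqrt lam"
  have s: "s > 0" "s * s = lam" using lam by (auto simp: s_def)
  define S where "S = {p :: (real^'n) \<times> (real^'p). A *v ((1 / s) *\<^sub>R snd p) + B *v fst p \<le> c}"
  have "closed S" unfolding S_def
    by (intro closed_feasible_set continuous_on_add continuous_on_matrix_vector_mult continuous_on_scaleR
        continuous_on_const continuous_on_fst continuous_on_snd continuous_on_id)
  moreover obtain \<xi>0 \<theta>0 where "A *v \<xi>0 + B *v \<theta>0 \<le> c" using feas by auto
  then have "(\<theta>0, s *\<^sub>R \<xi>0) \<in> S" using s by (simp add: S_def)
  then have "S \<noteq> {}" by auto
  ultimately obtain q where q: "q \<in> S" "\<And>p. p \<in> S \<Longrightarrow> dist (y, - ((1 / s) *\<^sub>R d)) q \<le> dist (y, - ((1 / s) *\<^sub>R d)) p"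
    by (rule distance_attains_inf) blast
  have obj: "qp_objective d lam y \<theta> \<xi>
      = (dist (y, - ((1 / s) *\<^sub>R d)) (\<theta>, s *\<^sub>R \<xi>))\<^sup>2 / 2 - (norm d)\<^sup>2 / (2 * lam)" for \<theta> \<xi>
  proof -
    have "(dist (y, - ((1 / s) *\<^sub>R d)) (\<theta>, s *\<^sub>R \<xi>))\<^sup>2
      = (norm (\<theta> - y))\<^sup>2 + (norm (s *\<^sub>R \<xi> + (1 / s) *\<^sub>R d))\<^sup>2"
      unfolding dist_Pair_Pair by (simp add: dist_norm norm_minus_commute[of y \<theta>]
        norm_minus_commute[of "- ((1 / s) *\<^sub>R d)" "s *\<^sub>R \<xi>"])
    also have "(norm (s *\<^sub>R \<xi> + (1 / s) *\<^sub>R d))\<^sup>2 = (s * s) * (\<xi> \<bullet> \<xi>) + 2 * (d \<bullet> \<xi>) + (d \<bullet> d) / (s * s)"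
      using s(1) unfolding power2_norm_eq_inner
      by (simp add: inner_simps inner_commute)
    finally show ?thesis
      unfolding qp_objective_def power2_norm_eq_inner s(2) using lam by (simp add: field_simps)
  qed
  define \<theta> where "\<theta> = fst q"
  define \<xi> where "\<xi> = (1 / s) *\<^sub>R snd q"
  have qeq: "q = (\<theta>, s *\<^sub>R \<xi>)" using s by (simp add: \<theta>_def \<xi>_def prod_eq_iff)
  have "qp_solution A B c d lam y \<theta> \<xi>"
    unfolding qp_solution_def is_arg_min_def
  proof (clarsimp, intro conjI allI impI)
    show "A *v \<xi> + B *v \<theta> \<le> c" using q(1) by (simp add: S_def \<theta>_def \<xi>_def)
    fix \<theta>' \<xi>' assume "A *v \<xi>' + B *v \<theta>' \<le> c"
    then have "(\<theta>', s *\<^sub>R \<xi>') \<in> S" using s by (simp add: S_def)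
    from q(2)[OF this] show "\<not> qp_objective d lam y \<theta>' \<xi>' < qp_objective d lam y \<theta> \<xi>"
      unfolding obj qeq not_less by (simp add: power_mono)
  qed
  then show ?thesis by blast
qed

text \<open>
  This is the cone of all pairs (right-hand side, upper bound of the value) of the linear programs that minimize
  \<open>d \<bullet> \<xi>\<close> subject to \<open>A \<xi> \<le> b\<close>.  It is closed because it is generated by finitely many vectors; the free variable \<open>\<xi>\<close>
  contributes each of its generators with both signs.
\<close>

lemma closed_perturbed_program_values:
  fixes A :: "real^'p^'m" and d :: "real^'p"
  shows "closed {(A *v \<xi> + s, d \<bullet> \<xi> + r) | \<xi> s r. s \<ge> 0 \<and> r \<ge> (0::real)}" (is "closed ?C")
proof -
  let ?g = "\<lambda>j. (A *v axis j 1, d $ j)"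
  define G where "G = range ?g \<union> range (\<lambda>j. - ?g j) \<union> range (\<lambda>i. (axis i 1, 0)) \<union> {(0, 1)}"
  define H where "H = convex_cone hull G"
  have HG: "g \<in> H" if "g \<in> G" for g using that unfolding H_def by (rule hull_inc)
  have H0: "0 \<in> H" unfolding H_def by (rule convex_cone_hull_contains_0)
  have Hadd: "x + z \<in> H" if "x \<in> H" "z \<in> H" for x z
    using that unfolding H_def by (rule convex_cone_hull_add)
  have Hmul: "a *\<^sub>R x \<in> H" if "x \<in> H" "0 \<le> a" for x a
    using that unfolding H_def by (rule convex_cone_hull_mul)
  have Hsum: "sum f K \<in> H" if "finite K" "\<And>x. x \<in> K \<Longrightarrow> f x \<in> H" for f and K :: "'k set"
    using that by (induction K rule: finite_induct) (auto intro: H0 Hadd)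
  have "?C = H"
  proof
    show "?C \<subseteq> H"
    proof clarify
      fix \<xi> and s :: "real^'m" and r :: real assume s: "s \<ge> 0" and r: "r \<ge> 0"
      have "\<xi> $ j *\<^sub>R ?g j \<in> H" for j
      proof (cases "\<xi> $ j \<ge> 0")
        case True
        then show ?thesis by (intro Hmul HG) (auto simp: G_def)
      next
        case False
        then have "(- (\<xi> $ j)) *\<^sub>R (- ?g j) \<in> H" by (intro Hmul HG) (auto simp: G_def)
        then show ?thesis by simp
      qed
      then have "(\<Sum>j\<in>UNIV. \<xi> $ j *\<^sub>R ?g j) \<in> H" by (intro Hsum) auto
      moreover have "(\<Sum>j\<in>UNIV. \<xi> $ j *\<^sub>R ?g j) = (A *v \<xi>, d \<bullet> \<xi>)"
        by (simp add: prod_eq_iff fst_sum snd_sum inner_vec_def mult.commute matrix_vector_mult_basis)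
          (simp add: vec_eq_iff matrix_vector_mult_def column_def mult.commute)
      moreover have "(\<Sum>i\<in>UNIV. s $ i *\<^sub>R (axis i 1, 0 :: real)) \<in> H"
        using s by (intro Hsum Hmul HG) (auto simp: G_def less_eq_vec_def)
      moreover have "(\<Sum>i\<in>UNIV. s $ i *\<^sub>R (axis i 1, 0 :: real)) = (s, 0)"
        by (simp add: prod_eq_iff fst_sum snd_sum vec_eq_iff axis_def if_distrib cong: if_cong)
      moreover have "r *\<^sub>R (0, 1) \<in> H" using r by (intro Hmul HG) (auto simp: G_def)
      ultimately have "(A *v \<xi>, d \<bullet> \<xi>) + (s, 0) + r *\<^sub>R (0, 1) \<in> H" by (simp only: Hadd)
      then show "(A *v \<xi> + s, d \<bullet> \<xi> + r) \<in> H" by simp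
    qed
    show "H \<subseteq> ?C"
      unfolding H_def
    proof (rule hull_minimal)
      have mem: "p \<in> ?C" if "fst p = A *v \<xi> + s" "snd p = d \<bullet> \<xi> + r" "s \<ge> 0" "r \<ge> 0" for p \<xi> s r
        using that by (cases p) auto
      show "G \<subseteq> ?C"
      proof
        fix g assume "g \<in> G"
        then consider j where "g = ?g j" | j where "g = - ?g j" | i where "g = (axis i 1, 0)" | "g = (0, 1)"
          unfolding G_def by blast
        then show "g \<in> ?C"
        proof cases
          case 1 then show ?thesis by (intro mem[of g "axis j 1" 0 0]) (auto simp: inner_axis)
        next
          case 2 then show ?thesis
            by (intro mem[of g "- axis j 1" 0 0]) (auto simp: inner_axis linear_neg[OF matrix_vector_mul_linear])
        next
          case 3 then show ?thesis
            by (intro mem[of g 0 "axis i 1" 0]) (auto simp: less_eq_vec_def axis_def)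
        next
          case 4 then show ?thesis by (intro mem[of g 0 0 1]) auto
        qed
      qed
      show "convex_cone ?C"
        unfolding convex_cone_iff
      proof (intro conjI ballI allI impI)
        show "0 \<in> ?C" by (intro mem[of 0 0 0 0]) auto
      next
        fix x z assume "x \<in> ?C" "z \<in> ?C"
        then obtain \<xi> s r \<xi>' s' r' where "x = (A *v \<xi> + s, d \<bullet> \<xi> + r)" "s \<ge> 0" "r \<ge> 0"
          "z = (A *v \<xi>' + s', d \<bullet> \<xi>' + r')" "s' \<ge> 0" "r' \<ge> 0" by blast
        then show "x + z \<in> ?C"
          by (intro mem[of "x + z" "\<xi> + \<xi>'" "s + s'" "r + r'"])
            (auto simp: matrix_vector_right_distrib inner_add_right)
      next
        fix x and a :: real assume "x \<in> ?C" "0 \<le> a"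
        then obtain \<xi> s r where "x = (A *v \<xi> + s, d \<bullet> \<xi> + r)" "s \<ge> 0" "r \<ge> 0" by blast
        with \<open>0 \<le> a\<close> show "a *\<^sub>R x \<in> ?C"
          by (intro mem[of "a *\<^sub>R x" "a *\<^sub>R \<xi>" "a *\<^sub>R s" "a * r"])
            (auto simp: matrix_vector_mult_scaleR algebra_simps scaleR_nonneg_nonneg)
      qed
    qed
  qed
  moreover have "closed H"
    unfolding H_def G_def by (intro polyhedron_imp_closed polyhedron_convex_cone_hull) auto
  ultimately show ?thesis by simp
qed

text \<open>
  The infimum over \<open>\<xi>\<close> must be shown to be attained although \<open>\<xi>\<close> may be unbounded on sublevel sets.  So \<open>\<xi>\<close> is
  eliminated: \<open>K\<close> is the set of pairs \<open>(\<theta>, t)\<close> such that some feasible \<open>\<xi>\<close> has \<open>d \<bullet> \<xi> \<le> t\<close>.  On \<open>K\<close> the multiplier \<open>u\<close>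
  bounds \<open>t\<close> below by an affine function of \<open>\<theta>\<close>, which the quadratic term dominates.
\<close>

lemma qp_solution_exists_zero:
  fixes A :: "real^'p^'m" and B :: "real^'n^'m"
  assumes feas: "{(\<xi>, \<theta>). A *v \<xi> + B *v \<theta> \<le> c} \<noteq> {}"
    and u: "u \<ge> 0" "- d = transpose A *v u"
  shows "\<exists>\<theta> \<xi>. qp_solution A B c d 0 y \<theta> \<xi>"
proof -
  let ?C = "{(A *v \<xi> + s, d \<bullet> \<xi> + r) | \<xi> s r. s \<ge> 0 \<and> r \<ge> (0::real)}"
  define K where "K = {p :: (real^'n) \<times> real. (c - B *v fst p, snd p) \<in> ?C}"
  have K_iff: "(\<theta>, t) \<in> K \<longleftrightarrow> (\<exists>\<xi>. A *v \<xi> + B *v \<theta> \<le> c \<and> d \<bullet> \<xi> \<le> t)" for \<theta> t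
  proof
    assume "(\<theta>, t) \<in> K"
    then obtain \<xi> s r where "c - B *v \<theta> = A *v \<xi> + s" "t = d \<bullet> \<xi> + r" "s \<ge> 0" "r \<ge> 0"
      by (auto simp: K_def)
    then have "A *v \<xi> + B *v \<theta> = c - s" "d \<bullet> \<xi> \<le> t" by (auto simp: algebra_simps)
    then show "\<exists>\<xi>. A *v \<xi> + B *v \<theta> \<le> c \<and> d \<bullet> \<xi> \<le> t" using \<open>s \<ge> 0\<close> by (intro exI[of _ \<xi>]) simp
  next
    assume "\<exists>\<xi>. A *v \<xi> + B *v \<theta> \<le> c \<and> d \<bullet> \<xi> \<le> t"
    then obtain \<xi> where \<xi>: "A *v \<xi> + B *v \<theta> \<le> c" "d \<bullet> \<xi> \<le> t" by blast
    have "(A *v \<xi> + (c - A *v \<xi> - B *v \<theta>), d \<bullet> \<xi> + (t - d \<bullet> \<xi>)) \<in> ?C"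
      using \<xi> by (intro CollectI exI[of _ \<xi>] exI[of _ "c - A *v \<xi> - B *v \<theta>"] exI[of _ "t - d \<bullet> \<xi>"])
        (simp add: le_diff_eq add.commute)
    then show "(\<theta>, t) \<in> K" by (simp add: K_def)
  qed
  have "continuous_on UNIV (\<lambda>p :: (real^'n) \<times> real. (c - B *v fst p, snd p))"
    by (intro continuous_on_Pair continuous_on_diff continuous_on_matrix_vector_mult
        continuous_on_const continuous_on_fst continuous_on_snd continuous_on_id)
  then have closedK: "closed K"
    unfolding K_def using closed_perturbed_program_values[of A d]
    by (intro closed_vimage[unfolded vimage_def, where f = "\<lambda>p. (c - B *v fst p, snd p)"])
  define f where "f p = (norm (fst p - y))\<^sup>2 / 2 + snd p" for p :: "(real^'n) \<times> real"
  define w where "w = transpose B *v u"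
  \<comment> \<open>Weak duality, with the dual feasible point \<open>u\<close>.\<close>
  have lower: "w \<bullet> \<theta> - u \<bullet> c \<le> t" if "(\<theta>, t) \<in> K" for \<theta> t
  proof -
    from that obtain \<xi> where \<xi>: "A *v \<xi> + B *v \<theta> \<le> c" "d \<bullet> \<xi> \<le> t"
      unfolding K_iff by blast
    have "0 \<le> u \<bullet> (c - (A *v \<xi> + B *v \<theta>))"
      using u(1) \<xi>(1) by (auto simp: inner_vec_def less_eq_vec_def intro!: sum_nonneg)
    also have "\<dots> = u \<bullet> c + d \<bullet> \<xi> - w \<bullet> \<theta>"
    proof -
      have "u \<bullet> (A *v \<xi>) = - (d \<bullet> \<xi>)" "u \<bullet> (B *v \<theta>) = w \<bullet> \<theta>"
        using u(2) by (simp_all add: w_def dot_lmul_matrix[symmetric] flip: inner_minus_left)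
      then show ?thesis by (simp add: inner_diff_right inner_add_right)
    qed
    finally show ?thesis using \<xi>(2) by simp
  qed
  obtain \<xi>0 \<theta>0 where "A *v \<xi>0 + B *v \<theta>0 \<le> c" using feas by auto
  then have p0: "(\<theta>0, d \<bullet> \<xi>0) \<in> K" unfolding K_iff by blast
  define f0 where "f0 = f (\<theta>0, d \<bullet> \<xi>0)"
  define S where "S = K \<inter> {p. f p \<le> f0}"
  have "continuous_on UNIV f" unfolding f_def by (intro continuous_intros) auto
  then have "closed S" unfolding S_def
    by (intro closed_Int closedK closed_Collect_le continuous_on_const)
  moreover have "bounded S"
  proof -
    define e where "e = f0 + u \<bullet> c - w \<bullet> y"
    \<comment> \<open>With \<open>r = norm (\<theta> - y)\<close>, completing the square gives \<open>(r - norm w)\<^sup>2 \<le> 2 * e + (norm w)\<^sup>2\<close>, and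
      \<open>a \<le> 1 + a\<^sup>2\<close> turns this into \<open>r \<le> R\<close> without a square root.\<close>
    define R where "R = norm w + 1 + 2 * e + (norm w)\<^sup>2"
    have "p \<in> cball y R \<times> {- (norm w * (norm y + R)) - u \<bullet> c .. f0}" if "p \<in> S" for p
    proof -
      obtain \<theta> t where p: "p = (\<theta>, t)" by (cases p)
      have K: "(\<theta>, t) \<in> K" and le: "(norm (\<theta> - y))\<^sup>2 / 2 + t \<le> f0"
        using that by (auto simp: S_def p f_def)
      have "(norm (\<theta> - y))\<^sup>2 / 2 + w \<bullet> (\<theta> - y) \<le> e"
        using le lower[OF K] by (simp add: e_def inner_diff_right)
      moreover have "- (norm w * norm (\<theta> - y)) \<le> w \<bullet> (\<theta> - y)"
        using Cauchy_Schwarz_ineq2[of w "\<theta> - y"] by linarith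
      ultimately have "(norm (\<theta> - y) - norm w)\<^sup>2 \<le> 2 * e + (norm w)\<^sup>2"
        by (simp add: power2_diff algebra_simps)
      moreover have "norm (\<theta> - y) - norm w \<le> 1 + (norm (\<theta> - y) - norm w)\<^sup>2"
        using zero_le_power2[of "norm (\<theta> - y) - norm w - 1/2"]
        by (simp add: power2_eq_square algebra_simps)
      ultimately have R: "norm (\<theta> - y) \<le> R" by (simp add: R_def)
      have "norm \<theta> \<le> norm y + R" using R norm_triangle_ineq2[of \<theta> y] by linarith
      then have "norm w * norm \<theta> \<le> norm w * (norm y + R)" by (intro mult_left_mono) auto
      then have "- (norm w * (norm y + R)) \<le> w \<bullet> \<theta>"
        using Cauchy_Schwarz_ineq2[of w \<theta>] by linarith
      then have "- (norm w * (norm y + R)) - u \<bullet> c \<le> t" using lower[OF K] by linarith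
      moreover have "t \<le> f0" using le zero_le_power2[of "norm (\<theta> - y)"] by linarith
      ultimately show ?thesis using R by (simp add: p dist_norm norm_minus_commute)
    qed
    then have "S \<subseteq> cball y R \<times> {- (norm w * (norm y + R)) - u \<bullet> c .. f0}" by blast
    then show ?thesis by (rule bounded_subset[rotated]) (intro bounded_Times bounded_cball bounded_closed_interval)
  qed
  ultimately have "compact S" by (simp add: compact_eq_bounded_closed)
  moreover have "S \<noteq> {}" using p0 by (auto simp: S_def f0_def)
  ultimately obtain p where p: "p \<in> S" "\<And>q. q \<in> S \<Longrightarrow> f p \<le> f q"
    using continuous_attains_inf[of S f] \<open>continuous_on UNIV f\<close> continuous_on_subset by blast
  obtain \<theta> t where pt: "p = (\<theta>, t)" by (cases p)
  obtain \<xi> where \<xi>: "A *v \<xi> + B *v \<theta> \<le> c" "d \<bullet> \<xi> \<le> t"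
    using p(1) K_iff by (auto simp: S_def pt)
  have "f p \<le> f q" if "q \<in> K" for q
    using p that by (cases "f q \<le> f0") (auto simp: S_def)
  then have "(norm (\<theta> - y))\<^sup>2 / 2 + t \<le> (norm (\<theta>' - y))\<^sup>2 / 2 + d \<bullet> \<xi>'"
    if "A *v \<xi>' + B *v \<theta>' \<le> c" for \<theta>' \<xi>'
    using that K_iff[of \<theta>' "d \<bullet> \<xi>'"] by (fastforce simp: f_def pt)
  then have "qp_solution A B c d 0 y \<theta> \<xi>"
    using \<xi> by (fastforce simp: qp_solution_def is_arg_min_def qp_objective_def)
  then show ?thesis by blast
qed

section \<open>Active rows\<close>

lemma row_submatrix_mult_component:
  "(row_submatrix I A *v x) $ i = (if i \<in> I then A $ i \<bullet> x else 0)"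
  by (auto simp: row_submatrix_def matrix_vector_mult_def inner_vec_def)

lemma transpose_row_submatrix_mult:
  "transpose (row_submatrix I A) *v u = (\<Sum>i\<in>I. u $ i *\<^sub>R A $ i)"
proof -
  have "(transpose (row_submatrix I A) *v u) $ j = (\<Sum>i\<in>UNIV. if i \<in> I then u $ i * A $ i $ j else 0)" for j
    by (auto simp: row_submatrix_def matrix_vector_mult_def transpose_def intro!: sum.cong)
  also have "\<dots> j = (\<Sum>i\<in>I. u $ i *\<^sub>R A $ i) $ j" for j
    by (simp add: sum.If_cases)
  finally show ?thesis by (simp add: vec_eq_iff)
qed

lemma independent_family_zero_combination:
  fixes r :: "'i \<Rightarrow> 'a::real_vector"
  assumes inj: "inj_on r I" and ind: "independent (r ` I)" and "finite I"
    and zero: "(\<Sum>i\<in>I. g i *\<^sub>R r i) = 0" and "i \<in> I"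
  shows "g i = 0"
proof -
  have "(\<Sum>v\<in>r ` I. g (inv_into I r v) *\<^sub>R v) = 0"
    using zero inj by (simp add: sum.reindex)
  from independentD[OF ind _ _ this, of "r i"] show ?thesis
    using assms by simp
qed

lemma indep_rows_zero_combination:
  assumes ind: "indep_rows A B I" and supp: "\<And>i. i \<notin> I \<Longrightarrow> u $ i = 0"
    and zero: "transpose (row_submatrix I A) *v u = 0" "transpose (row_submatrix I B) *v u = 0"
  shows "u = 0"
proof -
  have "(\<Sum>i\<in>I. u $ i *\<^sub>R (A $ i, B $ i)) = 0"
    using zero unfolding transpose_row_submatrix_mult by (simp add: prod_eq_iff fst_sum snd_sum)
  with ind have "u $ i = 0" if "i \<in> I" for i
    using independent_family_zero_combination[of "\<lambda>i. (A $ i, B $ i)" I "\<lambda>i. u $ i" i] that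
    by (simp add: indep_rows_def)
  with supp show ?thesis by (metis vec_eq_iff zero_index)
qed

lemma maximal_indep_rows_span:
  assumes max: "maximal_indep_rows A B J I"
  shows "span ((\<lambda>i. (A $ i, B $ i)) ` J) = span ((\<lambda>i. (A $ i, B $ i)) ` I)"
proof -
  let ?r = "\<lambda>i. (A $ i, B $ i)"
  have IJ: "I \<subseteq> J" and ind: "inj_on ?r I" "independent (?r ` I)"
    using max by (simp_all add: maximal_indep_rows_def indep_rows_def)
  have mx: "I' = I" if "I \<subseteq> I'" "I' \<subseteq> J" "indep_rows A B I'" for I'
    using max that unfolding maximal_indep_rows_def by blast
  have "?r j \<in> span (?r ` I)" if j: "j \<in> J" for j
  proof (rule ccontr)
    assume n: "?r j \<notin> span (?r ` I)"
    hence ni: "?r j \<notin> ?r ` I" by (meson span_base)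
    have "indep_rows A B (insert j I)"
      unfolding indep_rows_def using ind n ni
      by (auto simp: independent_insert inj_on_insert)
    with mx[of "insert j I"] IJ j have "insert j I = I" by auto
    with ni show False by auto
  qed
  hence "?r ` J \<subseteq> span (?r ` I)" by auto
  moreover have "?r ` I \<subseteq> span (?r ` J)"
    using IJ by (meson image_mono order_trans span_superset)
  ultimately show ?thesis by (simp only: span_eq)
qed

text \<open>
  The core of the piecewise affine structure: with the same index set \<open>I\<close>, both solutions satisfy the same affine
  equations.  The vectors \<open>c\<close> and \<open>d\<close> cancel in the differences, and the multiplier \<open>v\<close> is supported on \<open>I\<close> since the rows
  in \<open>I\<close> span all active rows.
\<close>

lemma qp_solution_difference:
  assumes s1: "qp_solution A B c d lam y1 \<theta>1 \<xi>1"
    and m1: "maximal_indep_rows A B (tight_rows A B c \<theta>1 \<xi>1) I"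
    and s2: "qp_solution A B c d lam y2 \<theta>2 \<xi>2"
    and m2: "maximal_indep_rows A B (tight_rows A B c \<theta>2 \<xi>2) I"
  obtains v where "\<And>i. i \<notin> I \<Longrightarrow> v $ i = 0"
    and "transpose (row_submatrix I A) *v v = lam *\<^sub>R (\<xi>1 - \<xi>2)"
    and "transpose (row_submatrix I B) *v v = (\<theta>1 - \<theta>2) - (y1 - y2)"
    and "row_submatrix I A *v (\<xi>1 - \<xi>2) + row_submatrix I B *v (\<theta>1 - \<theta>2) = 0"
proof -
  let ?r = "\<lambda>i. (A $ i, B $ i)"
  have inj: "inj_on ?r I"
    using m1 by (auto simp: maximal_indep_rows_def indep_rows_def)
  have "(d + lam *\<^sub>R \<xi>1, \<theta>1 - y1) - (d + lam *\<^sub>R \<xi>2, \<theta>2 - y2) \<in> span (?r ` I)"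
    using qp_stationarity[OF s1] qp_stationarity[OF s2]
      maximal_indep_rows_span[OF m1] maximal_indep_rows_span[OF m2]
    by (intro span_diff) auto
  then obtain w where w: "(lam *\<^sub>R (\<xi>1 - \<xi>2), (\<theta>1 - \<theta>2) - (y1 - y2)) = (\<Sum>x\<in>?r ` I. w x *\<^sub>R x)"
    by (auto simp: span_finite algebra_simps)
  define v where "v = (\<chi> i. if i \<in> I then w (?r i) else 0)"
  have "(lam *\<^sub>R (\<xi>1 - \<xi>2), (\<theta>1 - \<theta>2) - (y1 - y2)) = (\<Sum>i\<in>I. v $ i *\<^sub>R ?r i)"
    unfolding w by (simp add: sum.reindex[OF inj] v_def)
  hence 1: "(\<Sum>i\<in>I. v $ i *\<^sub>R A $ i) = lam *\<^sub>R (\<xi>1 - \<xi>2)"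
    "(\<Sum>i\<in>I. v $ i *\<^sub>R B $ i) = (\<theta>1 - \<theta>2) - (y1 - y2)"
    by (auto simp: prod_eq_iff fst_sum snd_sum)
  have "A $ i \<bullet> (\<xi>1 - \<xi>2) + B $ i \<bullet> (\<theta>1 - \<theta>2) = 0" if "i \<in> I" for i
    using m1 m2 that by (auto simp: maximal_indep_rows_def tight_rows_def inner_diff_right dest!: subsetD)
  hence "row_submatrix I A *v (\<xi>1 - \<xi>2) + row_submatrix I B *v (\<theta>1 - \<theta>2) = 0"
    by (simp add: vec_eq_iff row_submatrix_mult_component)
  with 1 show thesis by (intro that[of v]) (simp_all only: transpose_row_submatrix_mult, auto simp: v_def)
qed

section \<open>The linear pieces of the solution map\<close>

lemma block_mat1_mult_vec: "(block_mat1 I *v x) $ i = (if i \<in> I then x $ i else 0)"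
proof -
  have "(block_mat1 I *v x) $ i = (\<Sum>j\<in>UNIV. if j = i then (if i \<in> I then x $ i else 0) else 0)"
    unfolding block_mat1_def matrix_vector_mult_def vec_lambda_beta by (intro sum.cong) auto
  then show ?thesis by simp
qed

text \<open>
  Adding the identity on the coordinates outside \<open>I\<close> makes \<open>M\<close> an invertible square matrix that commutes with the
  coordinate projection \<open>P\<close>; compressing its inverse by \<open>P\<close> gives the block inverse.
\<close>

lemma is_block_inv_exists:
  fixes M :: "real^'m^'m"
  assumes supp: "\<forall>i j. i \<notin> I \<or> j \<notin> I \<longrightarrow> M $ i $ j = 0"
    and inj: "\<And>u. (\<And>i. i \<notin> I \<Longrightarrow> u $ i = 0) \<Longrightarrow> M *v u = 0 \<Longrightarrow> u = 0"
  shows "\<exists>X. is_block_inv I M X"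
proof -
  define P where "P = (block_mat1 I :: real^'m^'m)"
  define N where "N = M + (mat 1 - P)"
  have MP: "M ** P = M" and PM: "P ** M = M"
    using block_mat1_mult[OF supp] by (simp_all add: P_def)
  have PP: "P ** P = P" unfolding P_def by (rule block_mat1_mult) (auto simp: block_mat1_def)
  have Nv: "N *v x = M *v x + (x - P *v x)" for x
    by (simp add: N_def algebra_simps)
  have NP: "N ** P = M"
    unfolding matrix_eq by (simp add: matrix_vector_mul_assoc[symmetric] Nv)
      (simp add: matrix_vector_mul_assoc MP PP)
  have PN: "P ** N = M"
    unfolding matrix_eq by (simp add: matrix_vector_mul_assoc[symmetric] Nv algebra_simps)
      (simp add: matrix_vector_mul_assoc PM PP)
  have "u = 0" if "N *v u = 0" for u
  proof (rule inj)
    have "M *v u = N *v (P *v u)" by (simp add: matrix_vector_mul_assoc NP)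
    also have "\<dots> = P *v (N *v u)" by (simp add: matrix_vector_mul_assoc NP PN)
    finally show Mu: "M *v u = 0" using that by simp
    with that have "u = P *v u" by (simp add: Nv)
    then show "u $ i = 0" if "i \<notin> I" for i
      using that block_mat1_mult_vec[of I u i] by (simp add: P_def)
  qed
  then obtain Y where YN: "Y ** N = mat 1"
    using matrix_left_invertible_ker[of N] by blast
  then have NY: "N ** Y = mat 1" by (simp add: matrix_left_right_inverse)
  have PY: "P ** Y = Y ** P"
  proof -
    have "P ** Y = Y ** (N ** P) ** Y" by (simp add: matrix_mul_assoc YN)
    also have "\<dots> = Y ** (P ** N) ** Y" by (simp add: NP PN)
    also have "\<dots> = Y ** P ** (N ** Y)" by (simp add: matrix_mul_assoc)
    finally show ?thesis by (simp add: NY)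
  qed
  define X where "X = P ** Y"
  have "X $ i $ j = 0" if "i \<notin> I \<or> j \<notin> I" for i j
    using that
  proof
    assume "i \<notin> I"
    then show ?thesis by (simp add: X_def P_def block_mat1_def matrix_matrix_mult_def)
  next
    assume "j \<notin> I"
    then have "(Y ** P) $ i $ j = 0"
      by (auto simp: P_def block_mat1_def matrix_matrix_mult_def intro!: sum.neutral)
    then show ?thesis by (simp add: X_def PY)
  qed
  moreover have "M ** X = P"
  proof -
    have "M ** X = (M ** P) ** Y" by (simp add: X_def matrix_mul_assoc)
    also have "\<dots> = P ** (N ** Y)" by (simp add: MP PN matrix_mul_assoc)
    finally show ?thesis by (simp add: NY)
  qed
  moreover have "X ** M = P"
  proof -
    have "X ** M = Y ** (P ** M)" by (simp add: X_def PY matrix_mul_assoc)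
    also have "\<dots> = (Y ** N) ** P" by (simp add: PM NP matrix_mul_assoc[symmetric])
    finally show ?thesis by (simp add: YN)
  qed
  ultimately show ?thesis unfolding is_block_inv_def P_def by blast
qed

lemma inner_transpose_matrix_vector:
  fixes M :: "real^'n^'m"
  shows "(transpose M *v u) \<bullet> x = u \<bullet> (M *v x)"
  by (simp add: dot_lmul_matrix)

text \<open>
  The quadratic form of the matrix at \<open>u\<close> is \<open>|B\<^sub>I\<^sup>T u|\<^sup>2 + |A\<^sub>I\<^sup>T u|\<^sup>2 / lam\<close>, which vanishes only if
  the coefficients \<open>u\<close> combine the rows in \<open>I\<close> to zero, that is, for \<open>u = 0\<close>.
\<close>

lemma is_block_inv_gram:
  fixes A :: "real^'p^'m" and B :: "real^'n^'m" and lam :: real and I :: "'m set"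
  defines "A\<^sub>I \<equiv> row_submatrix I A" and "B\<^sub>I \<equiv> row_submatrix I B"
  defines "M \<equiv> B\<^sub>I ** transpose B\<^sub>I + (1 / lam) *\<^sub>R (A\<^sub>I ** transpose A\<^sub>I)"
  assumes "lam > 0" and ind: "indep_rows A B I"
  shows "is_block_inv I M (block_inv I M)"
proof -
  have Mv: "M *v u = B\<^sub>I *v (transpose B\<^sub>I *v u) + (1 / lam) *\<^sub>R (A\<^sub>I *v (transpose A\<^sub>I *v u))" for u
    unfolding M_def matrix_vector_mult_add_rdistrib scaleR_matrix_vector_assoc matrix_vector_mul_assoc ..
  have "\<exists>X. is_block_inv I M X"
  proof (rule is_block_inv_exists)
    show "\<forall>i j. i \<notin> I \<or> j \<notin> I \<longrightarrow> M $ i $ j = 0"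
      by (auto simp: M_def A\<^sub>I_def B\<^sub>I_def row_submatrix_def matrix_matrix_mult_def transpose_def)
    fix u :: "real^'m"
    assume supp: "\<And>i. i \<notin> I \<Longrightarrow> u $ i = 0" and "M *v u = 0"
    then have "0 = u \<bullet> (M *v u)" by simp
    also have "\<dots> = (norm (transpose B\<^sub>I *v u))\<^sup>2 + (1 / lam) * (norm (transpose A\<^sub>I *v u))\<^sup>2"
      unfolding Mv inner_add_right inner_scaleR_right power2_norm_eq_inner inner_transpose_matrix_vector ..
    finally have "(norm (transpose B\<^sub>I *v u))\<^sup>2 + (1 / lam) * (norm (transpose A\<^sub>I *v u))\<^sup>2 = 0" ..
    moreover have "0 \<le> (1 / lam) * (norm (transpose A\<^sub>I *v u))\<^sup>2" using \<open>lam > 0\<close> by simp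
    ultimately have "(norm (transpose B\<^sub>I *v u))\<^sup>2 = 0 \<and> (1 / lam) * (norm (transpose A\<^sub>I *v u))\<^sup>2 = 0"
      using zero_le_power2[of "norm (transpose B\<^sub>I *v u)"] by linarith
    then have "transpose A\<^sub>I *v u = 0" "transpose B\<^sub>I *v u = 0" using \<open>lam > 0\<close> by auto
    then show "u = 0" using indep_rows_zero_combination[OF ind supp] by (simp add: A\<^sub>I_def B\<^sub>I_def)
  qed
  then show ?thesis using block_inv_eqI by metis
qed

definition divergence_formula :: "real^'p^'m \<Rightarrow> real^'n^'m \<Rightarrow> real \<Rightarrow> 'm set \<Rightarrow> real"
  where "divergence_formula A B lam I =
    (let A\<^sub>I = row_submatrix I A; B\<^sub>I = row_submatrix I B
     in if lam > 0
        then real CARD('n) -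
          trace (transpose B\<^sub>I **
            block_inv I (B\<^sub>I ** transpose B\<^sub>I + (1 / lam) *\<^sub>R (A\<^sub>I ** transpose A\<^sub>I)) ** B\<^sub>I)
        else real CARD('n) - real (card I) + real (rank A\<^sub>I))"

text \<open>
  With \<open>\<Delta>\<xi> = A\<^sub>I\<^sup>T v / lam\<close> and \<open>\<Delta>\<theta> = \<Delta>y + B\<^sub>I\<^sup>T v\<close>, the relation \<open>A\<^sub>I \<Delta>\<xi> + B\<^sub>I \<Delta>\<theta> = 0\<close> reads \<open>M v = - B\<^sub>I \<Delta>y\<close>.
  The linear map depends on \<open>I\<close> only, which is why it is obtained before the two solutions are fixed.
\<close>

lemma solution_linear_on_piece_pos:
  fixes A :: "real^'p^'m" and B :: "real^'n^'m" and lam :: real and I :: "'m set"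
  assumes "lam > 0" and ind: "indep_rows A B I"
  obtains L where "linear L" "(\<Sum>i\<in>UNIV. L (axis i 1) $ i) = divergence_formula A B lam I"
    "\<And>c d y1 y2 \<theta>1 \<theta>2 \<xi>1 \<xi>2.
      \<lbrakk>qp_solution A B c d lam y1 \<theta>1 \<xi>1; maximal_indep_rows A B (tight_rows A B c \<theta>1 \<xi>1) I;
       qp_solution A B c d lam y2 \<theta>2 \<xi>2; maximal_indep_rows A B (tight_rows A B c \<theta>2 \<xi>2) I\<rbrakk>
      \<Longrightarrow> \<theta>1 - \<theta>2 = L (y1 - y2)"
proof -
  define A\<^sub>I where "A\<^sub>I = row_submatrix I A"
  define B\<^sub>I where "B\<^sub>I = row_submatrix I B"
  define M where "M = B\<^sub>I ** transpose B\<^sub>I + (1 / lam) *\<^sub>R (A\<^sub>I ** transpose A\<^sub>I)"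
  define X where "X = block_inv I M"
  have Mv: "M *v u = B\<^sub>I *v (transpose B\<^sub>I *v u) + (1 / lam) *\<^sub>R (A\<^sub>I *v (transpose A\<^sub>I *v u))" for u
    unfolding M_def matrix_vector_mult_add_rdistrib scaleR_matrix_vector_assoc matrix_vector_mul_assoc ..
  have inv: "X ** M = block_mat1 I"
    using is_block_inv_gram[OF assms] by (simp add: is_block_inv_def X_def M_def A\<^sub>I_def B\<^sub>I_def)
  define L where "L x = x - (transpose B\<^sub>I ** X ** B\<^sub>I) *v x" for x
  show thesis
  proof (rule that[of L])
    show "linear L" unfolding L_def by (intro linear_compose_sub linear_ident matrix_vector_mul_linear)
    have "(\<Sum>i\<in>UNIV. L (axis i 1) $ i)
      = (\<Sum>i\<in>UNIV. 1 - (transpose B\<^sub>I ** X ** B\<^sub>I) $ i $ i)"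
      by (simp add: L_def matrix_vector_mult_basis column_def)
    then show "(\<Sum>i\<in>UNIV. L (axis i 1) $ i) = divergence_formula A B lam I"
      using \<open>lam > 0\<close>
      by (simp add: sum_subtractf divergence_formula_def trace_def Let_def X_def M_def A\<^sub>I_def B\<^sub>I_def)
  next
    fix c d y1 y2 \<theta>1 \<theta>2 \<xi>1 \<xi>2
    assume "qp_solution A B c d lam y1 \<theta>1 \<xi>1" "maximal_indep_rows A B (tight_rows A B c \<theta>1 \<xi>1) I"
       "qp_solution A B c d lam y2 \<theta>2 \<xi>2" "maximal_indep_rows A B (tight_rows A B c \<theta>2 \<xi>2) I"
    then obtain v where supp: "\<And>i. i \<notin> I \<Longrightarrow> v $ i = 0"
      and a: "transpose A\<^sub>I *v v = lam *\<^sub>R (\<xi>1 - \<xi>2)"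
      and b: "transpose B\<^sub>I *v v = (\<theta>1 - \<theta>2) - (y1 - y2)"
      and t: "A\<^sub>I *v (\<xi>1 - \<xi>2) + B\<^sub>I *v (\<theta>1 - \<theta>2) = 0"
      unfolding A\<^sub>I_def B\<^sub>I_def by (rule qp_solution_difference) blast
    have "M *v v = B\<^sub>I *v ((\<theta>1 - \<theta>2) - (y1 - y2)) + A\<^sub>I *v (\<xi>1 - \<xi>2)"
      unfolding Mv a b using \<open>lam > 0\<close> by (simp add: matrix_vector_mult_scaleR)
    also have "\<dots> = - (B\<^sub>I *v (y1 - y2))"
      using t unfolding matrix_vector_mult_diff_distrib[of B\<^sub>I "\<theta>1 - \<theta>2"] by (simp add: algebra_simps)
    finally have Mv: "M *v v = - (B\<^sub>I *v (y1 - y2))" .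
    have "v = block_mat1 I *v v" using supp by (auto simp: vec_eq_iff block_mat1_mult_vec)
    also have "\<dots> = X *v (M *v v)" by (simp add: matrix_vector_mul_assoc inv)
    also have "\<dots> = - (X *v (B\<^sub>I *v (y1 - y2)))"
      unfolding Mv by (rule linear_neg[OF matrix_vector_mul_linear])
    finally have "transpose B\<^sub>I *v v = - (transpose B\<^sub>I *v (X *v (B\<^sub>I *v (y1 - y2))))"
      using linear_neg[OF matrix_vector_mul_linear, of "transpose B\<^sub>I" "X *v (B\<^sub>I *v (y1 - y2))"] by simp
    then show "\<theta>1 - \<theta>2 = L (y1 - y2)"
      unfolding b L_def matrix_vector_mul_assoc[symmetric] by (simp add: algebra_simps)
  qed
qed

text \<open>
  Rank and nullity of \<open>A\<^sub>I\<^sup>T\<close> on the coordinate subspace of \<open>I\<close>: the kernel is the orthogonal complement, inside that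
  subspace, of the range of \<open>A\<^sub>I\<close>.
\<close>

lemma dim_supported_kernel:
  fixes A :: "real^'p^'m" and I :: "'m set"
  shows "dim {u. (\<forall>i. i \<notin> I \<longrightarrow> u $ i = 0) \<and> transpose (row_submatrix I A) *v u = 0}
    + rank (row_submatrix I A) = card I"
proof -
  let ?A = "row_submatrix I A"
  let ?E = "{u :: real^'m. \<forall>i. i \<notin> I \<longrightarrow> u $ i = 0}"
  let ?R = "range (\<lambda>x. ?A *v x)"
  have "subspace ?R" by (rule linear_subspace_image[OF matrix_vector_mul_linear subspace_UNIV])
  moreover have "subspace ?E" by (auto simp: subspace_def)
  moreover have "?R \<subseteq> ?E" by (auto simp: row_submatrix_mult_component)
  ultimately have "dim {u \<in> ?E. \<forall>x\<in>?R. orthogonal x u} + dim ?R = dim ?E"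
    by (rule dim_subspace_orthogonal_to_vectors)
  moreover have "(\<forall>x\<in>?R. orthogonal x u) \<longleftrightarrow> transpose ?A *v u = 0" for u
  proof -
    have "(\<forall>x\<in>?R. orthogonal x u) \<longleftrightarrow> (\<forall>x. (transpose ?A *v u) \<bullet> x = 0)"
      unfolding inner_transpose_matrix_vector by (auto simp: orthogonal_def inner_commute)
    also have "\<dots> \<longleftrightarrow> transpose ?A *v u = 0"
      by (metis inner_eq_zero_iff inner_zero_left)
    finally show ?thesis .
  qed
  moreover have "dim ?E = card I"
    using dim_substandard_cart[where 'a = real and d = I] by (simp only: dim_vec_eq)
  ultimately show ?thesis by (simp add: rank_dim_range)
qed

text \<open>
  \<open>L\<close> is the orthogonal projection with kernel \<open>W\<close>, built from an orthonormal basis of \<open>W\<close>; each basis vector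
  lowers the trace by its squared norm, which is one.
\<close>

lemma subspace_residual:
  fixes W :: "(real^'n) set"
  assumes "subspace W"
  obtains L where "linear L" "(\<Sum>i\<in>UNIV. L (axis i 1) $ i) = real CARD('n) - real (dim W)"
    "\<And>x z. x - z \<in> W \<Longrightarrow> (\<And>w. w \<in> W \<Longrightarrow> w \<bullet> z = 0) \<Longrightarrow> z = L x"
proof -
  obtain C where C: "C \<subseteq> W" "pairwise orthogonal C" "\<And>x. x \<in> C \<Longrightarrow> norm x = 1"
    "independent C" "card C = dim W" "span C = W"
    using orthonormal_basis_subspace[OF assms] by metis
  have fin: "finite C" using C(4) by (rule independent_imp_finite)
  define L where "L x = x - (\<Sum>b\<in>C. (x \<bullet> b) *\<^sub>R b)" for x
  show thesis
  proof (rule that[of L])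
    show "linear L" unfolding L_def
      by (auto intro!: linearI simp: inner_simps algebra_simps sum.distrib scaleR_sum_right)
    have "(\<Sum>i\<in>UNIV. L (axis i 1) $ i) = (\<Sum>i\<in>UNIV. 1 - (\<Sum>b\<in>C. b $ i * b $ i))"
      by (simp add: L_def inner_axis')
    also have "\<dots> = real CARD('n) - (\<Sum>b\<in>C. \<Sum>i\<in>UNIV. b $ i * b $ i)"
      by (simp add: sum_subtractf sum.swap[of _ C])
    also have "(\<Sum>b\<in>C. \<Sum>i\<in>UNIV. b $ i * b $ i) = (\<Sum>b\<in>C. b \<bullet> b)"
      by (simp add: inner_vec_def)
    also have "\<dots> = real (dim W)"
      using C(3,5) by (simp add: norm_eq_1)
    finally show "(\<Sum>i\<in>UNIV. L (axis i 1) $ i) = real CARD('n) - real (dim W)" .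
  next
    fix x z assume xz: "x - z \<in> W" and z: "\<And>w. w \<in> W \<Longrightarrow> w \<bullet> z = 0"
    have "x - z = (\<Sum>b\<in>C. ((x - z) \<bullet> b) *\<^sub>R b)"
      using orthonormal_basis_expand[OF C(2,3) _ fin, of "x - z"] xz C(6) by simp
    also have "\<dots> = (\<Sum>b\<in>C. (x \<bullet> b) *\<^sub>R b)"
      using z C(1) by (intro sum.cong) (auto simp: inner_diff_left inner_commute[of z])
    finally show "z = L x" by (simp add: L_def algebra_simps)
  qed
qed

text \<open>
  Here \<open>A\<^sub>I\<^sup>T v = 0\<close>, so \<open>\<Delta>\<theta> - \<Delta>y\<close> lies in \<open>W\<close>.  For \<open>w = B\<^sub>I\<^sup>T u\<close> in \<open>W\<close> one has
  \<open>w \<bullet> \<Delta>\<theta> = u \<bullet> B\<^sub>I \<Delta>\<theta> = - u \<bullet> A\<^sub>I \<Delta>\<xi> = - A\<^sub>I\<^sup>T u \<bullet> \<Delta>\<xi> = 0\<close>, whatever the possibly non-unique \<open>\<xi>\<close> are.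
\<close>

lemma solution_linear_on_piece_zero:
  fixes A :: "real^'p^'m" and B :: "real^'n^'m" and I :: "'m set"
  assumes ind: "indep_rows A B I"
  obtains L where "linear L" "(\<Sum>i\<in>UNIV. L (axis i 1) $ i) = divergence_formula A B 0 I"
    "\<And>c d y1 y2 \<theta>1 \<theta>2 \<xi>1 \<xi>2.
      \<lbrakk>qp_solution A B c d 0 y1 \<theta>1 \<xi>1; maximal_indep_rows A B (tight_rows A B c \<theta>1 \<xi>1) I;
       qp_solution A B c d 0 y2 \<theta>2 \<xi>2; maximal_indep_rows A B (tight_rows A B c \<theta>2 \<xi>2) I\<rbrakk>
      \<Longrightarrow> \<theta>1 - \<theta>2 = L (y1 - y2)"
proof -
  define A\<^sub>I where "A\<^sub>I = row_submatrix I A"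
  define B\<^sub>I where "B\<^sub>I = row_submatrix I B"
  define K where "K = {u :: real^'m. (\<forall>i. i \<notin> I \<longrightarrow> u $ i = 0) \<and> transpose A\<^sub>I *v u = 0}"
  define W where "W = (\<lambda>u. transpose B\<^sub>I *v u) ` K"
  have subK: "subspace K"
    unfolding K_def subspace_def
    by (simp add: matrix_vector_right_distrib matrix_vector_mult_scaleR del: transpose_matrix_vector)
  have subW: "subspace W" unfolding W_def
    by (rule linear_subspace_image[OF matrix_vector_mul_linear subK])
  \<comment> \<open>On the kernel of \<open>A\<^sub>I\<^sup>T\<close>, independence of the rows in \<open>I\<close> is injectivity of \<open>B\<^sub>I\<^sup>T\<close>.\<close>
  have "inj_on (\<lambda>u. transpose B\<^sub>I *v u) K"
    unfolding linear_inj_on_iff_eq_0[OF matrix_vector_mul_linear subK]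
    using indep_rows_zero_combination[OF ind] by (auto simp: K_def A\<^sub>I_def B\<^sub>I_def simp del: transpose_matrix_vector)
  then have "dim W = dim K"
    unfolding W_def using subK
    by (intro dim_image_eq[OF matrix_vector_mul_linear]) (simp only: span_eq_iff[THEN iffD2])
  then have dimW: "real (dim W) = real (card I) - real (rank A\<^sub>I)"
    using dim_supported_kernel[of I A] unfolding K_def A\<^sub>I_def by linarith
  obtain L where L: "linear L" "(\<Sum>i\<in>UNIV. L (axis i 1) $ i) = real CARD('n) - real (dim W)"
    "\<And>x z. x - z \<in> W \<Longrightarrow> (\<And>w. w \<in> W \<Longrightarrow> w \<bullet> z = 0) \<Longrightarrow> z = L x"
    by (rule subspace_residual[OF subW]) blast
  show thesis
  proof (rule that[OF L(1)])
    show "(\<Sum>i\<in>UNIV. L (axis i 1) $ i) = divergence_formula A B 0 I"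
      unfolding L(2) dimW by (simp add: divergence_formula_def A\<^sub>I_def)
  next
    fix c d y1 y2 \<theta>1 \<theta>2 \<xi>1 \<xi>2
    assume "qp_solution A B c d 0 y1 \<theta>1 \<xi>1" "maximal_indep_rows A B (tight_rows A B c \<theta>1 \<xi>1) I"
       "qp_solution A B c d 0 y2 \<theta>2 \<xi>2" "maximal_indep_rows A B (tight_rows A B c \<theta>2 \<xi>2) I"
    then obtain v where supp: "\<And>i. i \<notin> I \<Longrightarrow> v $ i = 0"
      and a: "transpose A\<^sub>I *v v = 0 *\<^sub>R (\<xi>1 - \<xi>2)"
      and b: "transpose B\<^sub>I *v v = (\<theta>1 - \<theta>2) - (y1 - y2)"
      and t: "A\<^sub>I *v (\<xi>1 - \<xi>2) + B\<^sub>I *v (\<theta>1 - \<theta>2) = 0"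
      unfolding A\<^sub>I_def B\<^sub>I_def by (rule qp_solution_difference) blast
    show "\<theta>1 - \<theta>2 = L (y1 - y2)"
    proof (rule L(3))
      have "(\<theta>1 - \<theta>2) - (y1 - y2) \<in> W"
        unfolding W_def K_def b[symmetric] using supp a by (intro imageI) simp
      from subspace_neg[OF subW this] show "(y1 - y2) - (\<theta>1 - \<theta>2) \<in> W" by simp
    next
      fix w assume "w \<in> W"
      then obtain u where u: "transpose A\<^sub>I *v u = 0" "w = transpose B\<^sub>I *v u"
        by (auto simp: W_def K_def)
      have "w \<bullet> (\<theta>1 - \<theta>2) = u \<bullet> (B\<^sub>I *v (\<theta>1 - \<theta>2))"
        unfolding u(2) inner_transpose_matrix_vector ..
      also have "B\<^sub>I *v (\<theta>1 - \<theta>2) = - (A\<^sub>I *v (\<xi>1 - \<xi>2))" using t by (metis add_eq_0_iff)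
      also have "u \<bullet> \<dots> = - ((transpose A\<^sub>I *v u) \<bullet> (\<xi>1 - \<xi>2))"
        unfolding inner_transpose_matrix_vector by simp
      finally show "w \<bullet> (\<theta>1 - \<theta>2) = 0" unfolding u(1) by simp
    qed
  qed
qed

section \<open>Continuous selections of finitely many affine maps\<close>

lemma negligible_proper_affine:
  fixes S :: "'a::euclidean_space set"
  assumes "affine S" "S \<noteq> UNIV"
  shows "negligible S"
proof -
  have "aff_dim S < DIM('a)"
    using assms aff_dim_eq_full[of S] aff_dim_le_DIM[of S] by (simp add: less_le hull_same)
  then obtain a b where "a \<noteq> 0" "S \<subseteq> {x. a \<bullet> x = b}"
    by (rule aff_lowdim_subset_hyperplane)
  then show ?thesis using negligible_hyperplane[of a b] negligible_subset by blast
qed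

text \<open>
  The level sets of the selector \<open>\<kappa>\<close> may be arbitrarily irregular.  Outside the null set \<open>N\<close> where two distinct pieces agree, the value
  \<open>F y\<close> differs from \<open>T l y\<close> for every piece \<open>T l\<close> other than \<open>T (\<kappa> y)\<close>; by continuity this persists near \<open>y\<close>, so all
  nearby points select the same map \<open>T (\<kappa> y)\<close>, possibly under another index.
\<close>

lemma AE_has_derivative_affine_selection:
  fixes F :: "'a::euclidean_space \<Rightarrow> 'b::euclidean_space"
    and L :: "'k \<Rightarrow> 'a \<Rightarrow> 'b" and v :: "'k \<Rightarrow> 'b"
  assumes cont: "continuous_on UNIV F" and fin: "finite (range \<kappa>)"
    and lin: "\<And>k. k \<in> range \<kappa> \<Longrightarrow> linear (L k)"
    and sel: "\<And>y. F y = v (\<kappa> y) + L (\<kappa> y) y"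
  shows "AE y in lebesgue. (F has_derivative L (\<kappa> y)) (at y)"
proof -
  define T where "T k x = v k + L k x" for k x
  define E where "E k l = {x. T k x = T l x}" for k l
  define K where "K = {(k, l). (k, l) \<in> range \<kappa> \<times> range \<kappa> \<and> T l \<noteq> T k}"
  define N where "N = (\<Union>(k, l)\<in>K. E k l)"
  have finK: "finite K"
    using finite_subset[of K "range \<kappa> \<times> range \<kappa>"] fin by (auto simp: K_def)
  have contT: "continuous_on UNIV (T k)" if "k \<in> range \<kappa>" for k
    unfolding T_def using lin[OF that] by (intro continuous_intros linear_continuous_on) (simp add: linear_conv_bounded_linear)
  have "negligible (E k l)" if "k \<in> range \<kappa>" "l \<in> range \<kappa>" "T l \<noteq> T k" for k l
  proof (rule negligible_proper_affine)
    have comb: "T k (a *\<^sub>R x + b *\<^sub>R z) = a *\<^sub>R T k x + b *\<^sub>R T k z"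
      if "a + b = 1" "k \<in> range \<kappa>" for a b x z k
    proof -
      have "v k = (a + b) *\<^sub>R v k" using that by simp
      then show ?thesis using linear_add[OF lin[OF that(2)]] linear_scale[OF lin[OF that(2)]]
        by (simp add: T_def algebra_simps)
    qed
    show "affine (E k l)"
      using comb that by (auto simp: affine_def E_def)
    show "E k l \<noteq> UNIV" using that by (auto simp: E_def set_eq_iff)
  qed
  then have "negligible N"
    unfolding N_def using finK by (intro negligible_Union finite_imageI) (auto simp: K_def)
  then have "N \<in> null_sets lebesgue" by (simp add: negligible_iff_null_sets)
  then have "AE y in lebesgue. y \<notin> N" by (rule AE_not_in)
  then show ?thesis
  proof eventually_elim
    case (elim y)
    let ?k = "\<kappa> y"
    let ?O = "{l \<in> range \<kappa>. T l \<noteq> T ?k}"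
    have "\<forall>\<^sub>F z in at y. F z \<noteq> T l z" if l: "l \<in> ?O" for l
    proof -
      have "F y \<noteq> T l y"
        using elim l by (auto simp: N_def K_def E_def sel T_def[symmetric])
      moreover have "((\<lambda>z. F z - T l z) \<longlongrightarrow> F y - T l y) (at y)"
        using cont contT[of l] l by (auto intro!: tendsto_diff simp: continuous_on_def)
      ultimately have "\<forall>\<^sub>F z in at y. F z - T l z \<noteq> 0"
        by (intro tendsto_imp_eventually_ne) auto
      then show ?thesis by eventually_elim simp
    qed
    then have "\<forall>\<^sub>F z in at y. \<forall>l\<in>?O. F z \<noteq> T l z"
      using fin by (intro eventually_ball_finite) auto
    then have ev: "\<forall>\<^sub>F z in at y. F z = T ?k z"
    proof eventually_elim
      case (elim z)
      have "F z = T (\<kappa> z) z" by (simp add: sel T_def)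
      then show ?case using elim by (cases "T (\<kappa> z) = T ?k") auto
    qed
    have "(T ?k has_derivative L ?k) (at y)"
      unfolding T_def using lin[of ?k]
      by (auto intro!: derivative_eq_intros linear_imp_has_derivative)
    then show ?case
      by (rule has_derivative_transform_eventually) (use ev in \<open>auto simp: eq_commute sel T_def elim: eventually_mono\<close>)
  qed
qed

lemma has_field_derivative_along_axis:
  assumes "(f has_derivative f') (at y)"
  shows "((\<lambda>t. f (y + t *\<^sub>R axis i 1)) has_field_derivative f' (axis i 1)) (at 0)"
proof -
  have lin: "linear f'" using assms by (rule has_derivative_linear)
  have "((\<lambda>t. f (y + t *\<^sub>R axis i 1)) has_derivative (\<lambda>t. f' (t *\<^sub>R axis i 1))) (at 0)"
    by (rule has_derivative_compose[of "\<lambda>t. y + t *\<^sub>R axis i 1" "\<lambda>t. t *\<^sub>R axis i 1" 0 UNIV f f'])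
      (auto intro!: derivative_eq_intros assms)
  then show ?thesis
    by (simp add: has_field_derivative_def linear_scale[OF lin] mult.commute[of _ "f' _"])
qed

lemma partial_deriv_eq:
  assumes "(f has_derivative f') (at y)"
  shows "partial_deriv i f y = f' (axis i 1)"
  unfolding partial_deriv_def
  by (rule DERIV_imp_deriv[OF has_field_derivative_along_axis[OF assms]])

lemma divergence_eq_trace:
  assumes "(F has_derivative F') (at y)"
  shows "divergence F y = (\<Sum>i\<in>UNIV. F' (axis i 1) $ i)"
  unfolding divergence_def
  by (intro sum.cong refl partial_deriv_eq bounded_linear.has_derivative[OF bounded_linear_vec_nth assms])

section \<open>Stein's identity for Lipschitz functions\<close>

lemma isotropic_normal_density_eq:
  fixes x :: "real^'n"
  shows "isotropic_normal_density \<sigma> x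
    = (1 / sqrt (2 * pi * \<sigma>\<^sup>2)) ^ CARD('n) * exp (- (norm x)\<^sup>2 / (2 * \<sigma>\<^sup>2))"
proof -
  have sum: "(\<Sum>i\<in>UNIV. - (x $ i)\<^sup>2 / (2 * \<sigma>\<^sup>2)) = - (norm x)\<^sup>2 / (2 * \<sigma>\<^sup>2)"
    unfolding power2_norm_eq_inner inner_vec_def
    by (simp add: sum_negf sum_divide_distrib[symmetric] power2_eq_square)
  show ?thesis
    unfolding isotropic_normal_density_def normal_density_def diff_0_right prod.distrib prod_constant
      exp_sum[OF finite, symmetric] sum ..
qed

lemma isotropic_normal_density_nonneg: "0 \<le> isotropic_normal_density \<sigma> x"
  by (simp add: isotropic_normal_density_def prod_nonneg)

lemma borel_measurable_isotropic_normal_density [measurable]: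
  "isotropic_normal_density \<sigma> \<in> borel_measurable (borel :: (real^'n) measure)"
  unfolding isotropic_normal_density_eq by measurable

lemma isotropic_normal_density_shift:
  assumes "\<sigma> > 0"
  shows "isotropic_normal_density \<sigma> (x - t *\<^sub>R axis i 1)
    = isotropic_normal_density \<sigma> x * exp (t * ((2 * x $ i - t) / (2 * \<sigma>\<^sup>2)))"
proof -
  have expo: "- (norm (x - t *\<^sub>R axis i 1))\<^sup>2 / (2 * \<sigma>\<^sup>2)
    = - (norm x)\<^sup>2 / (2 * \<sigma>\<^sup>2) + t * ((2 * x $ i - t) / (2 * \<sigma>\<^sup>2))"
    using assms unfolding power2_norm_eq_inner
    by (simp add: inner_simps inner_axis inner_axis' inner_axis_axis field_simps)
  show ?thesis unfolding isotropic_normal_density_eq expo exp_add by (simp only: mult.assoc)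
qed

lemma integrable_lborel_scale:
  fixes f :: "'a::euclidean_space \<Rightarrow> real"
  assumes "integrable lborel f" and "c \<noteq> 0"
  shows "integrable lborel (\<lambda>x. f (c *\<^sub>R x))"
proof -
  have [measurable]: "f \<in> borel_measurable borel" using assms(1) by (simp add: borel_measurable_integrable)
  have "integrable (density (distr lborel borel (\<lambda>x. 0 + c *\<^sub>R x)) (\<lambda>_. ennreal (\<bar>c\<bar> ^ DIM('a)))) f"
    using assms(1) unfolding lborel_affine[OF assms(2), of 0, symmetric] by (simp add: ennreal_power)
  then show ?thesis
    using assms(2) by (simp add: integrable_density integrable_distr_eq)
qed

lemma lborel_integral_translate:
  fixes f :: "'a::euclidean_space \<Rightarrow> real"
  assumes [measurable]: "f \<in> borel_measurable borel"
  shows "(\<integral>x. f (a + x) \<partial>lborel) = (\<integral>x. f x \<partial>lborel)"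
proof -
  have "(\<integral>x. f x \<partial>lborel) = (\<integral>x. f x \<partial>distr lborel borel ((+) a))"
    by (simp only: lborel_distr_plus)
  also have "\<dots> = (\<integral>x. f (a + x) \<partial>lborel)" by (rule integral_distr) measurable
  finally show ?thesis ..
qed

text \<open>
  Completing the square absorbs the factor \<open>exp (\<alpha> * norm x)\<close> at the price of doubling the variance, and the
  wider density is a dilation of the given one, hence integrable as well.
\<close>

lemma integrable_isotropic_normal_exp_growth:
  fixes g :: "real^'n \<Rightarrow> real"
  assumes "\<sigma> > 0" and int: "integrable lborel (isotropic_normal_density \<sigma> :: real^'n \<Rightarrow> real)"
    and [measurable]: "g \<in> borel_measurable borel"
    and bound: "\<And>x. \<bar>g x\<bar> \<le> C * exp (\<alpha> * norm x)"
  shows "integrable lborel (\<lambda>x. isotropic_normal_density \<sigma> x * g x)"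
proof -
  define k where "k = (1 / sqrt (2 * pi * \<sigma>\<^sup>2)) ^ CARD('n)"
  have k: "k > 0" using \<open>\<sigma> > 0\<close> by (simp add: k_def)
  let ?h = "\<lambda>x :: real^'n. C * exp (\<alpha>\<^sup>2 * \<sigma>\<^sup>2) * isotropic_normal_density \<sigma> ((1 / sqrt 2) *\<^sub>R x)"
  have C: "0 \<le> C" using bound[of 0] by simp
  show ?thesis
  proof (rule Bochner_Integration.integrable_bound)
    show "integrable lborel ?h"
      by (intro integrable_mult_right integrable_lborel_scale int) simp
    show "(\<lambda>x. isotropic_normal_density \<sigma> x * g x) \<in> borel_measurable lborel" by measurable
    have "norm (isotropic_normal_density \<sigma> x * g x) \<le> norm (?h x)" for x
    proof -
      have sq: "- (norm x)\<^sup>2 / (2 * \<sigma>\<^sup>2) + \<alpha> * norm x \<le> \<alpha>\<^sup>2 * \<sigma>\<^sup>2 - (norm x)\<^sup>2 / (4 * \<sigma>\<^sup>2)"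
      proof -
        have "norm x * \<alpha> \<le> (norm x)\<^sup>2 / (4 * \<sigma>\<^sup>2) + \<alpha>\<^sup>2 * \<sigma>\<^sup>2"
          using \<open>\<sigma> > 0\<close> zero_le_power2[of "norm x / (2 * \<sigma>) - \<alpha> * \<sigma>"]
          by (simp add: power2_diff power_divide power_mult_distrib)
        moreover have "(norm x)\<^sup>2 / (2 * \<sigma>\<^sup>2) = 2 * ((norm x)\<^sup>2 / (4 * \<sigma>\<^sup>2))" by simp
        ultimately show ?thesis unfolding minus_divide_left[symmetric] by (simp add: mult.commute)
      qed
      have "norm (isotropic_normal_density \<sigma> x * g x)
        = isotropic_normal_density \<sigma> x * \<bar>g x\<bar>"
        by (simp add: abs_mult isotropic_normal_density_nonneg)
      also have "\<dots> \<le> isotropic_normal_density \<sigma> x * (C * exp (\<alpha> * norm x))"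
        by (intro mult_left_mono bound isotropic_normal_density_nonneg)
      also have "\<dots> = (C * k) * exp (- (norm x)\<^sup>2 / (2 * \<sigma>\<^sup>2) + \<alpha> * norm x)"
        by (simp only: isotropic_normal_density_eq k_def exp_add mult_ac)
      also have "\<dots> \<le> (C * k) * exp (\<alpha>\<^sup>2 * \<sigma>\<^sup>2 - (norm x)\<^sup>2 / (4 * \<sigma>\<^sup>2))"
        using sq C k by (intro mult_left_mono) auto
      also have "\<dots> = ?h x"
        by (simp add: isotropic_normal_density_eq k_def exp_diff exp_minus power_divide power_mult_distrib field_simps)
      also have "\<dots> \<le> norm (?h x)" by simp
      finally show ?thesis .
    qed
    then show "AE x in lborel. norm (isotropic_normal_density \<sigma> x * g x) \<le> norm (?h x)" by simp
  qed
qed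

lemma le_exp: "x \<le> exp x" for x :: real
  using exp_ge_add_one_self[of x] by linarith

lemma abs_exp_minus_one_le: "\<bar>exp a - 1\<bar> \<le> \<bar>a\<bar> * exp \<bar>a\<bar>" for a :: real
proof (cases "a \<ge> 0")
  case True
  have "(1 - a) * exp a \<le> exp (- a) * exp a"
    using exp_ge_add_one_self[of "- a"] by (intro mult_right_mono) auto
  also have "\<dots> = 1" by (simp add: exp_minus)
  finally show ?thesis using True by (simp add: algebra_simps)
next
  case False
  then have "exp a < 1" by simp
  then have "\<bar>exp a - 1\<bar> \<le> \<bar>a\<bar> * 1" using False exp_ge_add_one_self[of a] by linarith
  also have "\<dots> \<le> \<bar>a\<bar> * exp \<bar>a\<bar>" by (intro mult_left_mono) auto
  finally show ?thesis .
qed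

text \<open>
  A majorant that does not depend on \<open>t\<close>, as dominated convergence requires: shifting by \<open>t\<close> multiplies the
  density by \<open>exp (t * a)\<close> with \<open>a\<close> of at most linear growth in \<open>x\<close>.
\<close>

lemma isotropic_normal_difference_quotient_bound:
  assumes "\<sigma> > 0" "0 < t" "t \<le> 1"
  shows "\<bar>(isotropic_normal_density \<sigma> (x - t *\<^sub>R axis i 1) - isotropic_normal_density \<sigma> x) / t\<bar>
    \<le> isotropic_normal_density \<sigma> x * exp (2 * ((norm x + 1) / \<sigma>\<^sup>2))"
proof -
  define a where "a = (2 * x $ i - t) / (2 * \<sigma>\<^sup>2)"
  define b where "b = (norm x + 1) / \<sigma>\<^sup>2"
  have "\<bar>2 * x $ i - t\<bar> \<le> 2 * norm x + 1"
    using component_le_norm_cart[of x i] assms by linarith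
  then have "\<bar>a\<bar> \<le> (2 * norm x + 1) / (2 * \<sigma>\<^sup>2)"
    unfolding a_def using assms by (simp add: divide_right_mono)
  also have "\<dots> \<le> b" using assms by (simp add: b_def field_simps)
  finally have ab: "\<bar>a\<bar> \<le> b" .
  have "\<bar>t * a\<bar> \<le> 1 * \<bar>a\<bar>" unfolding abs_mult using assms by (intro mult_right_mono) auto
  then have ta: "\<bar>t * a\<bar> \<le> b" using ab by simp
  have "\<bar>exp (t * a) - 1\<bar> / t \<le> \<bar>t * a\<bar> * exp \<bar>t * a\<bar> / t"
    using assms by (intro divide_right_mono abs_exp_minus_one_le) auto
  also have "\<dots> = \<bar>a\<bar> * exp \<bar>t * a\<bar>" using assms by (simp add: abs_mult)
  also have "\<dots> \<le> exp b * exp b"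
    using ab ta order_trans[OF ab le_exp] by (intro mult_mono) auto
  also have "\<dots> = exp (2 * b)" by (simp add: exp_add[symmetric])
  finally have "isotropic_normal_density \<sigma> x * (\<bar>exp (t * a) - 1\<bar> / t) \<le> isotropic_normal_density \<sigma> x * exp (2 * b)"
    by (intro mult_left_mono isotropic_normal_density_nonneg)
  moreover have "(isotropic_normal_density \<sigma> (x - t *\<^sub>R axis i 1) - isotropic_normal_density \<sigma> x) / t
      = isotropic_normal_density \<sigma> x * ((exp (t * a) - 1) / t)"
    unfolding isotropic_normal_density_shift[OF assms(1)] a_def by (simp add: algebra_simps diff_divide_distrib)
  ultimately show ?thesis
    using assms by (simp add: abs_mult isotropic_normal_density_nonneg b_def)
qed

lemma isotropic_normal_difference_quotient_tendsto:
  assumes "\<sigma> > 0"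
  shows "((\<lambda>t. (isotropic_normal_density \<sigma> (x - t *\<^sub>R axis i 1) - isotropic_normal_density \<sigma> x) / t)
    \<longlongrightarrow> x $ i / \<sigma>\<^sup>2 * isotropic_normal_density \<sigma> x) (at 0)"
proof -
  have "((\<lambda>t. isotropic_normal_density \<sigma> x * exp (t * ((2 * x $ i - t) / (2 * \<sigma>\<^sup>2))))
    has_field_derivative x $ i / \<sigma>\<^sup>2 * isotropic_normal_density \<sigma> x) (at 0)"
    using assms by (auto intro!: derivative_eq_intros simp: power2_eq_square power4_eq_xxxx)
  then show ?thesis
    unfolding isotropic_normal_density_shift[OF assms] DERIV_def by simp
qed

text \<open>
  Translation by \<open>t\<close> along the \<open>i\<close>-th axis shows that the difference quotients of \<open>f\<close>, integrated against the
  density, and those of the density, integrated against \<open>f\<close>, have equal integrals.  The quotients \<open>q n\<close> of \<open>f\<close> are dominated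
  by a multiple of the density, because \<open>f\<close> is Lipschitz, and the quotients \<open>p n\<close> of the density by the function \<open>w\<close>.
\<close>

lemma stein_identity:
  fixes f :: "real^'n \<Rightarrow> real"
  assumes \<sigma>: "\<sigma> > 0" and int: "integrable lborel (isotropic_normal_density \<sigma> :: real^'n \<Rightarrow> real)"
    and lip: "\<And>x z. \<bar>f x - f z\<bar> \<le> L * norm (x - z)"
    and D [measurable]: "D \<in> borel_measurable borel"
    and deriv: "AE x in lborel. ((\<lambda>t. f (x + t *\<^sub>R axis i 1)) has_field_derivative D x) (at 0)"
  shows "integrable lborel (\<lambda>x. isotropic_normal_density \<sigma> x * f x)"
    and "integrable lborel (\<lambda>x. isotropic_normal_density \<sigma> x * (x $ i * f x))"
    and "integrable lborel (\<lambda>x. isotropic_normal_density \<sigma> x * D x)"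
    and "(\<integral>x. isotropic_normal_density \<sigma> x * (x $ i * f x) \<partial>lborel)
      = \<sigma>\<^sup>2 * (\<integral>x. isotropic_normal_density \<sigma> x * D x \<partial>lborel)"
proof -
  define \<phi> where "\<phi> = (isotropic_normal_density \<sigma> :: real^'n \<Rightarrow> real)"
  define e where "e = (axis i 1 :: real^'n)"
  define t where "t n = 1 / real (Suc n)" for n
  have t: "0 < t n" "t n \<le> 1" for n by (auto simp: t_def)
  have t0: "filterlim t (at 0) sequentially"
    unfolding t_def filterlim_at using LIMSEQ_inverse_real_of_nat by (auto simp: inverse_eq_divide)
  have \<phi>0: "0 \<le> \<phi> x" for x by (simp add: \<phi>_def isotropic_normal_density_nonneg)
  have L: "0 \<le> L" using lip[of e 0] abs_ge_zero[of "f e - f 0"] by (simp add: e_def)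
  have "L-lipschitz_on UNIV f"
    using lip L by (auto simp: lipschitz_on_def dist_norm)
  then have "continuous_on UNIV f" by (rule lipschitz_on_continuous_on)
  then have f_meas [measurable]: "f \<in> borel_measurable borel" by (rule borel_measurable_continuous_onI)
  have \<phi>_meas [measurable]: "\<phi> \<in> borel_measurable borel" unfolding \<phi>_def by measurable
  define c where "c = \<bar>f 0\<bar> + L"
  have growth: "\<bar>f x\<bar> \<le> c * exp (norm x)" for x
  proof -
    have "\<bar>f x\<bar> \<le> \<bar>f 0\<bar> * 1 + L * norm x" using lip[of x 0] by simp
    also have "\<dots> \<le> \<bar>f 0\<bar> * exp (norm x) + L * exp (norm x)"
      using L by (intro add_mono mult_left_mono le_exp) auto
    finally show ?thesis by (simp add: c_def algebra_simps)
  qed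
  show int_f: "integrable lborel (\<lambda>x. isotropic_normal_density \<sigma> x * f x)"
    by (rule integrable_isotropic_normal_exp_growth[OF \<sigma> int, where C = c and \<alpha> = 1]) (use growth in auto)
  \<comment> \<open>Difference quotients along \<open>t n\<close> of the function and of the density, and the majorant of the latter.\<close>
  define q where "q n x = \<phi> x * ((f (x + t n *\<^sub>R e) - f x) / t n)" for n x
  define p where "p n x = f x * ((\<phi> (x - t n *\<^sub>R e) - \<phi> x) / t n)" for n x
  define w where "w x = \<phi> x * (c * exp (norm x) * exp (2 * ((norm x + 1) / \<sigma>\<^sup>2)))" for x
  have int_w: "integrable lborel w"
    unfolding w_def \<phi>_def
  proof (rule integrable_isotropic_normal_exp_growth[OF \<sigma> int, where C = "c * exp (2 / \<sigma>\<^sup>2)" and \<alpha> = "1 + 2 / \<sigma>\<^sup>2"])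
    show "\<bar>c * exp (norm x) * exp (2 * ((norm x + 1) / \<sigma>\<^sup>2))\<bar>
      \<le> c * exp (2 / \<sigma>\<^sup>2) * exp ((1 + 2 / \<sigma>\<^sup>2) * norm x)" for x
      using L by (simp add: c_def abs_mult exp_add[symmetric] mult.assoc add_divide_distrib algebra_simps)
  qed measurable
  have q_meas: "q n \<in> borel_measurable lborel" for n
    unfolding q_def by measurable
  have p_meas: "p n \<in> borel_measurable lborel" for n
    unfolding p_def by measurable
  have q_lim: "AE x in lborel. (\<lambda>n. q n x) \<longlonglongrightarrow> \<phi> x * D x"
    using deriv
  proof eventually_elim
    case (elim x)
    then have "((\<lambda>h. (f (x + h *\<^sub>R e) - f x) / h) \<longlongrightarrow> D x) (at 0)"
      by (simp add: DERIV_def e_def)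
    from filterlim_compose[OF this t0] show ?case
      unfolding q_def by (intro tendsto_mult_left)
  qed
  have q_bound: "norm (q n x) \<le> L * \<phi> x" for n x
  proof -
    have "\<bar>f (x + t n *\<^sub>R e) - f x\<bar> \<le> L * t n"
      using lip[of "x + t n *\<^sub>R e" x] t[of n] by (simp add: e_def)
    then have "\<bar>(f (x + t n *\<^sub>R e) - f x) / t n\<bar> \<le> L" using t[of n] by (simp add: divide_le_eq)
    then have "\<phi> x * \<bar>(f (x + t n *\<^sub>R e) - f x) / t n\<bar> \<le> \<phi> x * L"
      using \<phi>0 by (intro mult_left_mono)
    then show ?thesis using \<phi>0[of x] unfolding q_def real_norm_def abs_mult by (simp add: mult.commute)
  qed
  have int_L: "integrable lborel (\<lambda>x. L * \<phi> x)" using int unfolding \<phi>_def by simp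
  have m: "(\<lambda>x. \<phi> x * D x) \<in> borel_measurable lborel" by measurable
  have dct_q: "integrable lborel (\<lambda>x. \<phi> x * D x)" "\<And>n. integrable lborel (q n)"
    "(\<lambda>n. \<integral>x. q n x \<partial>lborel) \<longlonglongrightarrow> (\<integral>x. \<phi> x * D x \<partial>lborel)"
    using integrable_dominated_convergence[OF m q_meas int_L q_lim]
      integrable_dominated_convergence2[OF m q_meas int_L q_lim]
      integral_dominated_convergence[OF m q_meas int_L q_lim] q_bound by simp_all
  show "integrable lborel (\<lambda>x. isotropic_normal_density \<sigma> x * D x)"
    using dct_q(1) by (simp add: \<phi>_def)
  have p_lim: "(\<lambda>n. p n x) \<longlonglongrightarrow> f x * (x $ i / \<sigma>\<^sup>2 * \<phi> x)" for x
    unfolding p_def \<phi>_def e_def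
    by (intro tendsto_mult_left filterlim_compose[OF isotropic_normal_difference_quotient_tendsto[OF \<sigma>] t0])
  have p_bound: "norm (p n x) \<le> w x" for n x
  proof -
    have "\<bar>f x\<bar> * \<bar>(\<phi> (x - t n *\<^sub>R e) - \<phi> x) / t n\<bar>
      \<le> (c * exp (norm x)) * (\<phi> x * exp (2 * ((norm x + 1) / \<sigma>\<^sup>2)))"
      unfolding \<phi>_def e_def
      by (intro mult_mono growth isotropic_normal_difference_quotient_bound \<sigma> t) (use L in \<open>auto simp: c_def\<close>)
    then show ?thesis unfolding p_def w_def real_norm_def abs_mult by (simp add: mult_ac)
  qed
  have m: "(\<lambda>x. f x * (x $ i / \<sigma>\<^sup>2 * \<phi> x)) \<in> borel_measurable lborel" by measurable
  have dct_p: "integrable lborel (\<lambda>x. f x * (x $ i / \<sigma>\<^sup>2 * \<phi> x))"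
    "\<And>n. integrable lborel (p n)"
    "(\<lambda>n. \<integral>x. p n x \<partial>lborel) \<longlonglongrightarrow> (\<integral>x. f x * (x $ i / \<sigma>\<^sup>2 * \<phi> x) \<partial>lborel)"
    using integrable_dominated_convergence[OF m p_meas int_w AE_I2[OF p_lim]]
      integrable_dominated_convergence2[OF m p_meas int_w AE_I2[OF p_lim]]
      integral_dominated_convergence[OF m p_meas int_w AE_I2[OF p_lim]] p_bound by simp_all
  have "\<sigma>\<^sup>2 * (f x * (x $ i / \<sigma>\<^sup>2 * \<phi> x)) = \<phi> x * (x $ i * f x)" for x using \<sigma> by simp
  then have score: "(\<lambda>x. isotropic_normal_density \<sigma> x * (x $ i * f x)) = (\<lambda>x. \<sigma>\<^sup>2 * (f x * (x $ i / \<sigma>\<^sup>2 * \<phi> x)))"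
    by (simp add: \<phi>_def)
  show "integrable lborel (\<lambda>x. isotropic_normal_density \<sigma> x * (x $ i * f x))"
    unfolding score using dct_p(1) by (intro integrable_mult_right)
  have "(\<integral>x. q n x \<partial>lborel) = (\<integral>x. p n x \<partial>lborel)" for n
  proof -
    have int1: "integrable lborel (\<lambda>x. \<phi> x * f x)" using int_f by (simp add: \<phi>_def)
    have eq1: "\<phi> x * f (x + t n *\<^sub>R e) = t n * q n x + \<phi> x * f x" for x
      using t[of n] by (simp add: q_def field_simps)
    have eq2: "\<phi> (x - t n *\<^sub>R e) * f x = t n * p n x + \<phi> x * f x" for x
      using t[of n] by (simp add: p_def field_simps)
    have "(\<integral>x. \<phi> x * f (x + t n *\<^sub>R e) \<partial>lborel) = (\<integral>x. \<phi> (x - t n *\<^sub>R e) * f x \<partial>lborel)"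
      using lborel_integral_translate[of "\<lambda>x. \<phi> (x - t n *\<^sub>R e) * f x" "t n *\<^sub>R e"]
      by (simp add: add.commute)
    then have "t n * (\<integral>x. q n x \<partial>lborel) = t n * (\<integral>x. p n x \<partial>lborel)"
      unfolding eq1 eq2 using dct_q(2) int1 dct_p(2) by simp
    then show ?thesis using t[of n] by simp
  qed
  then have "(\<integral>x. \<phi> x * D x \<partial>lborel) = (\<integral>x. f x * (x $ i / \<sigma>\<^sup>2 * \<phi> x) \<partial>lborel)"
    using LIMSEQ_unique[OF dct_q(3)] dct_p(3) by simp
  then show "(\<integral>x. isotropic_normal_density \<sigma> x * (x $ i * f x) \<partial>lborel)
      = \<sigma>\<^sup>2 * (\<integral>x. isotropic_normal_density \<sigma> x * D x \<partial>lborel)"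
    unfolding score integral_mult_right_zero by (simp only: \<phi>_def)
qed

text \<open>
  The limit \<open>l\<close> of one sequence of difference quotients is measurable, and by continuity of \<open>f\<close> it suffices to test
  rational increments in order to decide whether \<open>l y\<close> is the derivative, which makes the set \<open>P\<close> of such points Borel.  At all
  other points \<open>deriv\<close> chooses an element of the empty set of derivatives, which is the same number everywhere.
  Borel functions remain measurable when they are composed with the noise on a probability space that may be
  incomplete.
\<close>

lemma borel_measurable_partial_deriv:
  fixes f :: "real^'n \<Rightarrow> real"
  assumes cont: "continuous_on UNIV f"
  shows "partial_deriv i f \<in> borel_measurable borel"
proof -
  define e where "e = (axis i 1 :: real^'n)"
  have [measurable]: "f \<in> borel_measurable borel" using cont by (rule borel_measurable_continuous_onI)
  define l where "l y = lim (\<lambda>n. (f (y + (1 / real (Suc n)) *\<^sub>R e) - f y) / (1 / real (Suc n)))" for y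
  have [measurable]: "l \<in> borel_measurable borel" unfolding l_def by measurable
  define P where "P y \<longleftrightarrow> (\<forall>k::nat. \<exists>m::nat. \<forall>r::rat. \<bar>of_rat r\<bar> < 1 / real (Suc m) \<longrightarrow>
    \<bar>f (y + of_rat r *\<^sub>R e) - f y - l y * of_rat r\<bar> \<le> \<bar>of_rat r\<bar> / real (Suc k))" for y
  have [measurable]: "Measurable.pred borel P" unfolding P_def by measurable
  have 1: "l y = D \<and> P y" if "((\<lambda>h. f (y + h *\<^sub>R e)) has_field_derivative D) (at 0)" for y D
  proof
    have lim: "((\<lambda>h. (f (y + h *\<^sub>R e) - f y) / h) \<longlongrightarrow> D) (at 0)"
      using that by (simp add: DERIV_def)
    have "filterlim (\<lambda>n. 1 / real (Suc n)) (at 0) sequentially"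
      unfolding filterlim_at using LIMSEQ_inverse_real_of_nat by (auto simp: inverse_eq_divide)
    from filterlim_compose[OF lim this] show lD: "l y = D"
      unfolding l_def by (rule limI)
    show "P y" unfolding P_def
    proof
      fix k :: nat
      from lim have "\<exists>s>0. \<forall>h. h \<noteq> 0 \<and> norm (h - 0) < s \<longrightarrow> norm ((f (y + h *\<^sub>R e) - f y) / h - D) < 1 / real (Suc k)"
        by (rule LIM_D) simp
      then obtain s where s: "s > 0" "\<And>h. h \<noteq> 0 \<Longrightarrow> \<bar>h\<bar> < s \<Longrightarrow> \<bar>(f (y + h *\<^sub>R e) - f y) / h - D\<bar> < 1 / real (Suc k)"
        by auto
      obtain m where m: "1 / real (Suc m) < s" using reals_Archimedean[OF s(1)] by (auto simp: inverse_eq_divide)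
      have "\<bar>f (y + h *\<^sub>R e) - f y - l y * h\<bar> \<le> \<bar>h\<bar> / real (Suc k)" if "\<bar>h\<bar> < 1 / real (Suc m)" for h
      proof (cases "h = 0")
        case False
        have "f (y + h *\<^sub>R e) - f y - l y * h = h * ((f (y + h *\<^sub>R e) - f y) / h - D)"
          using False lD by (simp add: field_simps)
        then have "\<bar>f (y + h *\<^sub>R e) - f y - l y * h\<bar> = \<bar>h\<bar> * \<bar>(f (y + h *\<^sub>R e) - f y) / h - D\<bar>"
          by (simp add: abs_mult)
        also have "\<dots> \<le> \<bar>h\<bar> * (1 / real (Suc k))"
          using s(2)[of h] False that m by (intro mult_left_mono) auto
        finally show ?thesis by simp
      qed simp
      then show "\<exists>m::nat. \<forall>r::rat. \<bar>of_rat r\<bar> < 1 / real (Suc m) \<longrightarrow>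
        \<bar>f (y + of_rat r *\<^sub>R e) - f y - l y * of_rat r\<bar> \<le> \<bar>of_rat r\<bar> / real (Suc k)" by blast
    qed
  qed
  have 2: "((\<lambda>h. f (y + h *\<^sub>R e)) has_field_derivative l y) (at 0)" if "P y" for y
    unfolding DERIV_def
  proof (rule LIM_I)
    fix \<epsilon> :: real assume "\<epsilon> > 0"
    then obtain k where k: "1 / real (Suc k) < \<epsilon>" using reals_Archimedean by (auto simp: inverse_eq_divide)
    from \<open>P y\<close> obtain m where m: "\<And>r::rat. \<bar>of_rat r\<bar> < 1 / real (Suc m) \<Longrightarrow>
      \<bar>f (y + of_rat r *\<^sub>R e) - f y - l y * of_rat r\<bar> \<le> \<bar>of_rat r\<bar> / real (Suc k)"
      unfolding P_def by blast
    let ?U = "{h. \<bar>h\<bar> < 1 / real (Suc m)} \<inter> {h. \<bar>h\<bar> / real (Suc k) < \<bar>f (y + h *\<^sub>R e) - f y - l y * h\<bar>}"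
    have "continuous_on UNIV (\<lambda>h. f (y + h *\<^sub>R e))"
      by (rule continuous_on_compose2[OF cont]) (auto intro!: continuous_intros)
    then have "open ?U"
      by (intro open_Int open_Collect_less continuous_intros) auto
    have notin: "h \<notin> ?U" for h
    proof
      assume "h \<in> ?U"
      with \<open>open ?U\<close> obtain d where d: "d > 0" "ball h d \<subseteq> ?U" using open_contains_ball by blast
      obtain r where "r \<in> \<rat>" "h < r" "r < h + d" using Rats_dense_in_real[of h "h + d"] d(1) by auto
      then have "r \<in> ball h d" by (simp add: dist_real_def)
      then have "r \<in> ?U" using d(2) by blast
      moreover obtain r' where "r = of_rat r'" using \<open>r \<in> \<rat>\<close> by (auto elim: Rats_cases)
      ultimately show False using m[of r'] by (auto simp: not_less[symmetric])
    qed
    then have bd: "\<bar>f (y + h *\<^sub>R e) - f y - l y * h\<bar> \<le> \<bar>h\<bar> / real (Suc k)" if "\<bar>h\<bar> < 1 / real (Suc m)" for h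
      using that notin[of h] by (simp only: Int_iff mem_Collect_eq not_less simp_thms)
    have "norm ((f (y + h *\<^sub>R e) - f y) / h - l y) < \<epsilon>" if "h \<noteq> 0" "\<bar>h\<bar> < 1 / real (Suc m)" for h
    proof -
      have "norm ((f (y + h *\<^sub>R e) - f y) / h - l y) = \<bar>f (y + h *\<^sub>R e) - f y - l y * h\<bar> / \<bar>h\<bar>"
        using that by (simp add: abs_divide[symmetric] diff_divide_distrib)
      also have "\<dots> \<le> (\<bar>h\<bar> / real (Suc k)) / \<bar>h\<bar>" using bd[OF that(2)] by (intro divide_right_mono) auto
      also have "\<dots> < \<epsilon>" using k that by simp
      finally show ?thesis .
    qed
    then show "\<exists>s>0. \<forall>h. h \<noteq> 0 \<and> norm (h - 0) < s \<longrightarrow>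
      norm ((f (y + (0 + h) *\<^sub>R e) - f (y + 0 *\<^sub>R e)) / h - l y) < \<epsilon>"
      by (intro exI[of _ "1 / real (Suc m)"]) auto
  qed
  have "partial_deriv i f y = (if P y then l y else (SOME D :: real. False))" for y
  proof (cases "P y")
    case True
    then show ?thesis using DERIV_imp_deriv[OF 2[OF True]] by (simp add: partial_deriv_def e_def)
  next
    case False
    then have "((\<lambda>h. f (y + h *\<^sub>R e)) has_field_derivative D) (at 0) \<longleftrightarrow> False" for D
      using 1 by blast
    then show ?thesis using False by (simp add: partial_deriv_def deriv_def e_def)
  qed
  then have "partial_deriv i f = (\<lambda>y. if P y then l y else (SOME D :: real. False))" by blast
  then show ?thesis by simp
qed

section \<open>Divergence and degrees of freedom\<close>

lemma solution_linear_on_piece: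
  fixes A :: "real^'p^'m" and B :: "real^'n^'m" and I :: "'m set"
  assumes "lam \<ge> 0" and "indep_rows A B I"
  shows "\<exists>L. linear L \<and> (\<Sum>i\<in>UNIV. L (axis i 1) $ i) = divergence_formula A B lam I \<and>
    (\<forall>c d y1 y2 \<theta>1 \<theta>2 \<xi>1 \<xi>2.
      qp_solution A B c d lam y1 \<theta>1 \<xi>1 \<and> maximal_indep_rows A B (tight_rows A B c \<theta>1 \<xi>1) I \<and>
      qp_solution A B c d lam y2 \<theta>2 \<xi>2 \<and> maximal_indep_rows A B (tight_rows A B c \<theta>2 \<xi>2) I
      \<longrightarrow> \<theta>1 - \<theta>2 = L (y1 - y2))"
proof (cases "lam = 0")
  case True
  show ?thesis unfolding True by (rule solution_linear_on_piece_zero[OF assms(2)]) blast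
next
  case False
  with assms(1) have "lam > 0" by simp
  then show ?thesis by (rule solution_linear_on_piece_pos[OF _ assms(2)]) blast
qed

lemma AE_solution_derivative:
  fixes A :: "real^'p^'m" and B :: "real^'n^'m"
  assumes lam: "lam \<ge> 0"
    and sol: "\<And>y. qp_solution A B c d lam y (\<theta>h y) (\<xi>h y)"
    and max: "\<And>y. maximal_indep_rows A B (tight_rows A B c (\<theta>h y) (\<xi>h y)) (I y)"
    and cont: "continuous_on UNIV \<theta>h"
  shows "AE y in lebesgue. \<theta>h differentiable (at y) \<and>
    divergence \<theta>h y = divergence_formula A B lam (I y)"
proof -
  have "\<exists>L. linear L \<and> (\<Sum>i\<in>UNIV. L (axis i 1) $ i) = divergence_formula A B lam k \<and>
      (\<forall>y z. I y = k \<longrightarrow> I z = k \<longrightarrow> \<theta>h y - \<theta>h z = L (y - z))" if "k \<in> range I" for k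
  proof -
    from that max have "indep_rows A B k" by (auto simp: maximal_indep_rows_def)
    from solution_linear_on_piece[OF lam this] obtain L where L: "linear L"
      "(\<Sum>i\<in>UNIV. L (axis i 1) $ i) = divergence_formula A B lam k"
      "\<forall>c d y1 y2 \<theta>1 \<theta>2 \<xi>1 \<xi>2.
        qp_solution A B c d lam y1 \<theta>1 \<xi>1 \<and> maximal_indep_rows A B (tight_rows A B c \<theta>1 \<xi>1) k \<and>
        qp_solution A B c d lam y2 \<theta>2 \<xi>2 \<and> maximal_indep_rows A B (tight_rows A B c \<theta>2 \<xi>2) k
        \<longrightarrow> \<theta>1 - \<theta>2 = L (y1 - y2)" by blast
    have "\<theta>h y - \<theta>h z = L (y - z)" if "I y = k" "I z = k" for y z
      using L(3) sol[of y] sol[of z] max[of y] max[of z] unfolding that by blast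
    with L(1,2) show ?thesis by blast
  qed
  then have "\<exists>L. \<forall>k\<in>range I. linear (L k) \<and>
      (\<Sum>i\<in>UNIV. L k (axis i 1) $ i) = divergence_formula A B lam k \<and>
      (\<forall>y z. I y = k \<longrightarrow> I z = k \<longrightarrow> \<theta>h y - \<theta>h z = L k (y - z))" by (intro bchoice) blast
  then obtain L where L: "\<forall>k\<in>range I. linear (L k) \<and>
      (\<Sum>i\<in>UNIV. L k (axis i 1) $ i) = divergence_formula A B lam k \<and>
      (\<forall>y z. I y = k \<longrightarrow> I z = k \<longrightarrow> \<theta>h y - \<theta>h z = L k (y - z))" ..
  have lin: "linear (L k)" if "k \<in> range I" for k using L that by blast
  have tr: "(\<Sum>i\<in>UNIV. L (I y) (axis i 1) $ i) = divergence_formula A B lam (I y)" for y using L by blast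
  have diff: "\<theta>h y - \<theta>h z = L (I y) (y - z)" if "I z = I y" for y z using L that by blast
  define y0 where "y0 k = (SOME y. I y = k)" for k
  have y0: "I (y0 (I y)) = I y" for y unfolding y0_def by (rule someI[of "\<lambda>z. I z = I y" y]) simp
  define v where "v k = \<theta>h (y0 k) - L k (y0 k)" for k
  have "AE y in lebesgue. (\<theta>h has_derivative L (I y)) (at y)"
  proof (rule AE_has_derivative_affine_selection[OF cont _ lin])
    show "finite (range I)" by simp
    fix y
    show "\<theta>h y = v (I y) + L (I y) y"
      using diff[OF y0, of y] linear_diff[OF lin[of "I y"], of y "y0 (I y)"]
      by (simp add: v_def algebra_simps)
  qed
  then show ?thesis
  proof eventually_elim
    case (elim y)
    then show ?case using divergence_eq_trace[OF elim] tr[of y] by (auto simp: differentiable_def)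
  qed
qed

lemma partial_deriv_Lipschitz_bound:
  assumes diff: "f differentiable (at y)" and lip: "\<And>x z. \<bar>f x - f z\<bar> \<le> norm (x - z)"
  shows "((\<lambda>t. f (y + t *\<^sub>R axis i 1)) has_field_derivative partial_deriv i f y) (at 0)"
    and "\<bar>partial_deriv i f y\<bar> \<le> 1"
proof -
  obtain f' where f': "(f has_derivative f') (at y)" using diff by (auto simp: differentiable_def)
  show D: "((\<lambda>t. f (y + t *\<^sub>R axis i 1)) has_field_derivative partial_deriv i f y) (at 0)"
    unfolding partial_deriv_eq[OF f'] by (rule has_field_derivative_along_axis[OF f'])
  have "((\<lambda>h. \<bar>(f (y + h *\<^sub>R axis i 1) - f y) / h\<bar>) \<longlongrightarrow> \<bar>partial_deriv i f y\<bar>) (at 0)"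
    using D unfolding DERIV_def by (intro tendsto_rabs) simp
  moreover have "\<bar>(f (y + h *\<^sub>R axis i 1) - f y) / h\<bar> \<le> 1" if "h \<noteq> 0" for h
    using lip[of "y + h *\<^sub>R axis i 1" y] that by (simp add: divide_le_eq)
  then have "\<forall>\<^sub>F h in at 0. \<bar>(f (y + h *\<^sub>R axis i 1) - f y) / h\<bar> \<le> 1"
    by (auto simp: eventually_at_filter)
  ultimately show "\<bar>partial_deriv i f y\<bar> \<le> 1"
    by (rule tendsto_upperbound) simp
qed

text \<open>
  Stein's identity is applied to each component of the shifted map \<open>x \<mapsto> F (\<theta>s + x)\<close>.  Applied to the constant function one,
  it also says that the noise is integrable with mean zero.
\<close>

lemma degrees_of_freedom_eq_expected_divergence:
  fixes F :: "real^'n \<Rightarrow> real^'n" and M :: "'w measure" and \<epsilon> :: "'w \<Rightarrow> real^'n"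
  assumes lip: "\<And>x z. norm (F x - F z) \<le> norm (x - z)"
    and diff: "AE y in lebesgue. F differentiable (at y)"
    and M: "prob_space M" and \<sigma>: "\<sigma> > 0"
    and \<epsilon>: "distributed M lborel \<epsilon> (\<lambda>x. ennreal (isotropic_normal_density \<sigma> x))"
  shows "has_covariance M (\<lambda>\<omega>. F (\<theta>s + \<epsilon> \<omega>) $ i) (\<lambda>\<omega>. (\<theta>s + \<epsilon> \<omega>) $ i)"
    and "integrable M (\<lambda>\<omega>. divergence F (\<theta>s + \<epsilon> \<omega>))"
    and "degrees_of_freedom M \<sigma> (\<lambda>\<omega>. \<theta>s + \<epsilon> \<omega>) F = (\<integral>\<omega>. divergence F (\<theta>s + \<epsilon> \<omega>) \<partial>M)"
proof -
  interpret prob_space M by fact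
  note integral_iff = distributed_integral[OF \<epsilon> _ isotropic_normal_density_nonneg]
  note integrable_iff = distributed_integrable[OF \<epsilon> _ isotropic_normal_density_nonneg]
  have int: "integrable lborel (isotropic_normal_density \<sigma> :: real^'n \<Rightarrow> real)"
    using integrable_iff[of "\<lambda>_. 1"] by simp
  have "1-lipschitz_on UNIV F" using lip by (auto simp: lipschitz_on_def dist_norm)
  then have contF: "continuous_on UNIV F" by (rule lipschitz_on_continuous_on)
  define f where "f j x = F (\<theta>s + x) $ j" for j x
  define D where "D j x = partial_deriv j (\<lambda>z. F z $ j) (\<theta>s + x)" for j x
  have lipF: "\<bar>F x $ j - F z $ j\<bar> \<le> norm (x - z)" for j x z
    using component_le_norm_cart[of "F x - F z" j] lip[of x z] by simp
  have lipf: "\<bar>f j x - f j z\<bar> \<le> 1 * norm (x - z)" for j x z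
    using lipF[of "\<theta>s + x" j "\<theta>s + z"] by (simp add: f_def)
  have contf: "continuous_on UNIV (f j)" for j
    unfolding f_def by (intro continuous_on_component continuous_on_compose2[OF contF] continuous_intros) auto
  have f_meas [measurable]: "f j \<in> borel_measurable borel" for j
    using contf by (rule borel_measurable_continuous_onI)
  have D_meas [measurable]: "D j \<in> borel_measurable borel" for j
  proof -
    have "partial_deriv j (\<lambda>z. F z $ j) \<in> borel_measurable borel"
      by (intro borel_measurable_partial_deriv continuous_on_component contF)
    then show ?thesis unfolding D_def by measurable
  qed
  have deriv: "AE x in lborel. ((\<lambda>t. f j (x + t *\<^sub>R axis j 1)) has_field_derivative D j x) (at 0)" for j
  proof -
    obtain N where N: "N \<in> null_sets lebesgue" "{y. \<not> F differentiable (at y)} \<subseteq> N"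
      using diff by (auto simp: eventually_ae_filter)
    then have "negligible ((+) (- \<theta>s) ` N)" by (intro negligible_translation) (simp add: negligible_iff_null_sets)
    then have "(+) (- \<theta>s) ` N \<in> null_sets lebesgue" by (simp add: negligible_iff_null_sets)
    then have "AE x in lebesgue. x \<notin> (+) (- \<theta>s) ` N" by (rule AE_not_in)
    then have "AE x in lebesgue. ((\<lambda>t. f j (x + t *\<^sub>R axis j 1)) has_field_derivative D j x) (at 0)"
    proof eventually_elim
      case (elim x)
      have "\<theta>s + x \<notin> N"
        using elim image_eqI[of x "(+) (- \<theta>s)" "\<theta>s + x" N] by auto
      then have "F differentiable (at (\<theta>s + x))" using N(2) by blast
      then have "(\<lambda>z. F z $ j) differentiable (at (\<theta>s + x))"
        by (auto simp: differentiable_def intro: bounded_linear.has_derivative[OF bounded_linear_vec_nth])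
      from partial_deriv_Lipschitz_bound(1)[OF this lipF]
      show ?case by (simp add: f_def D_def add.assoc)
    qed
    then show ?thesis by (simp add: AE_completion_iff)
  qed
  note stein = stein_identity[OF \<sigma> int lipf D_meas deriv]
  have const: "integrable lborel (\<lambda>x. isotropic_normal_density \<sigma> x * (x $ j * 1))"
    "(\<integral>x. isotropic_normal_density \<sigma> x * (x $ j * 1) \<partial>lborel) = 0" for j :: 'n
    using stein_identity[OF \<sigma> int, of "\<lambda>_. 1" 0 "\<lambda>_. 0" j] by simp_all
  have int_f: "integrable M (\<lambda>\<omega>. f j (\<epsilon> \<omega>))" for j
    using stein(1) integrable_iff[of "f j"] by simp
  have int_xf: "integrable M (\<lambda>\<omega>. \<epsilon> \<omega> $ j * f j (\<epsilon> \<omega>))" for j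
    using stein(2) integrable_iff[of "\<lambda>x. x $ j * f j x"] by simp
  have int_D: "integrable M (\<lambda>\<omega>. D j (\<epsilon> \<omega>))" for j
    using stein(3) integrable_iff[of "D j"] by simp
  have int_\<epsilon>: "integrable M (\<lambda>\<omega>. \<epsilon> \<omega> $ j)" for j
    using const(1)[of j] integrable_iff[of "\<lambda>x. x $ j"] by simp
  have mean_\<epsilon>: "(\<integral>\<omega>. \<epsilon> \<omega> $ j \<partial>M) = 0" for j
    using const(2)[of j] integral_iff[of "\<lambda>x. x $ j"] by simp
  have stein_M: "(\<integral>\<omega>. \<epsilon> \<omega> $ j * f j (\<epsilon> \<omega>) \<partial>M) = \<sigma>\<^sup>2 * (\<integral>\<omega>. D j (\<epsilon> \<omega>) \<partial>M)" for j
    using stein(4)[of j] integral_iff[of "\<lambda>x. x $ j * f j x"] integral_iff[of "D j"] by simp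
  show "has_covariance M (\<lambda>\<omega>. F (\<theta>s + \<epsilon> \<omega>) $ i) (\<lambda>\<omega>. (\<theta>s + \<epsilon> \<omega>) $ i)"
    unfolding has_covariance_def
    using int_f[of i] int_xf[of i] int_\<epsilon>[of i]
    by (simp add: f_def[symmetric] distrib_left mult.commute)
  have div: "divergence F (\<theta>s + x) = (\<Sum>j\<in>UNIV. D j x)" for x
    by (simp add: divergence_def D_def)
  show "integrable M (\<lambda>\<omega>. divergence F (\<theta>s + \<epsilon> \<omega>))"
    unfolding div using int_D by simp
  have "covariance M (\<lambda>\<omega>. F (\<theta>s + \<epsilon> \<omega>) $ j) (\<lambda>\<omega>. (\<theta>s + \<epsilon> \<omega>) $ j) = \<sigma>\<^sup>2 * (\<integral>\<omega>. D j (\<epsilon> \<omega>) \<partial>M)" for j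
  proof -
    define m where "m = (\<integral>\<omega>. f j (\<epsilon> \<omega>) \<partial>M)"
    have mean: "(\<integral>\<omega>. (\<theta>s + \<epsilon> \<omega>) $ j \<partial>M) = \<theta>s $ j"
      using int_\<epsilon> mean_\<epsilon> by (simp add: prob_space)
    have "covariance M (\<lambda>\<omega>. F (\<theta>s + \<epsilon> \<omega>) $ j) (\<lambda>\<omega>. (\<theta>s + \<epsilon> \<omega>) $ j)
      = (\<integral>\<omega>. \<epsilon> \<omega> $ j * f j (\<epsilon> \<omega>) - m * \<epsilon> \<omega> $ j \<partial>M)"
      unfolding covariance_def mean by (simp add: f_def m_def algebra_simps)
    also have "\<dots> = \<sigma>\<^sup>2 * (\<integral>\<omega>. D j (\<epsilon> \<omega>) \<partial>M)"
      using int_xf int_\<epsilon> mean_\<epsilon> by (simp add: stein_M)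
    finally show ?thesis .
  qed
  then have "degrees_of_freedom M \<sigma> (\<lambda>\<omega>. \<theta>s + \<epsilon> \<omega>) F = (\<Sum>j\<in>UNIV. \<integral>\<omega>. D j (\<epsilon> \<omega>) \<partial>M)"
    unfolding degrees_of_freedom_def using \<sigma> by (simp add: sum_distrib_left[symmetric])
  also have "\<dots> = (\<integral>\<omega>. divergence F (\<theta>s + \<epsilon> \<omega>) \<partial>M)"
    unfolding div using int_D by simp
  finally show "degrees_of_freedom M \<sigma> (\<lambda>\<omega>. \<theta>s + \<epsilon> \<omega>) F = (\<integral>\<omega>. divergence F (\<theta>s + \<epsilon> \<omega>) \<partial>M)" .
qed

lemma essentially_bounded_gradient:
  assumes lip: "\<And>x z. \<bar>f x - f z\<bar> \<le> norm (x - z)" and diff: "almost_differentiable (f :: real^'n \<Rightarrow> real)"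
  shows "essentially_bounded (gradient f)"
proof -
  have "AE y in lebesgue. norm (gradient f y) \<le> real CARD('n)"
    using diff unfolding almost_differentiable_def
  proof eventually_elim
    case (elim y)
    have "norm (gradient f y) \<le> (\<Sum>j\<in>UNIV. \<bar>gradient f y $ j\<bar>)" by (rule norm_le_l1_cart)
    also have "\<dots> \<le> (\<Sum>j\<in>(UNIV :: 'n set). 1)"
      using partial_deriv_Lipschitz_bound(2)[OF elim lip] by (intro sum_mono) (simp add: gradient_def)
    finally show ?case by simp
  qed
  then show ?thesis unfolding essentially_bounded_def by blast
qed

theorem theorem3p2:
  fixes A :: "real^'p^'m" and B :: "real^'n^'m" and c :: "real^'m" and d :: "real^'p"
    and lam :: real
  assumes "lam \<ge> 0"
    and "{(\<xi>, \<theta>). A *v \<xi> + B *v \<theta> \<le> c} \<noteq> {}"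
    and "lam = 0 \<Longrightarrow> \<exists>u. u \<ge> 0 \<and> - d = transpose A *v u"
  shows "(\<forall>y. \<exists>!\<theta>. \<exists>\<xi>. qp_solution A B c d lam y \<theta> \<xi>) \<and>
    (\<forall>(\<theta>h :: real^'n \<Rightarrow> real^'n) (\<xi>h :: real^'n \<Rightarrow> real^'p) (I :: real^'n \<Rightarrow> 'm set).
      (\<forall>y. qp_solution A B c d lam y (\<theta>h y) (\<xi>h y)) \<and>
      (\<forall>y. maximal_indep_rows A B (tight_rows A B c (\<theta>h y) (\<xi>h y)) (I y)) \<longrightarrow>
      (\<forall>i. almost_differentiable (\<lambda>y. \<theta>h y $ i) \<and>
           essentially_bounded (gradient (\<lambda>y. \<theta>h y $ i))) \<and>
      (AE y in lebesgue. divergence \<theta>h y =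
        (let A\<^sub>I = row_submatrix (I y) A; B\<^sub>I = row_submatrix (I y) B
         in if lam > 0
            then real CARD('n) -
              trace (transpose B\<^sub>I **
                block_inv (I y) (B\<^sub>I ** transpose B\<^sub>I + (1 / lam) *\<^sub>R (A\<^sub>I ** transpose A\<^sub>I)) **
                B\<^sub>I)
            else real CARD('n) - real (card (I y)) + real (rank A\<^sub>I))) \<and>
      (\<forall>(M :: 'w measure) (\<epsilon> :: 'w \<Rightarrow> real^'n) (\<theta>s :: real^'n) (\<sigma> :: real).
        prob_space M \<and> \<sigma> > 0 \<and>
        distributed M lborel \<epsilon> (\<lambda>x. ennreal (isotropic_normal_density \<sigma> x)) \<longrightarrow>
        (\<forall>i. has_covariance M (\<lambda>\<omega>. \<theta>h (\<theta>s + \<epsilon> \<omega>) $ i) (\<lambda>\<omega>. (\<theta>s + \<epsilon> \<omega>) $ i)) \<and>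
        integrable M (\<lambda>\<omega>. divergence \<theta>h (\<theta>s + \<epsilon> \<omega>)) \<and>
        degrees_of_freedom M \<sigma> (\<lambda>\<omega>. \<theta>s + \<epsilon> \<omega>) \<theta>h =
          (\<integral>\<omega>. divergence \<theta>h (\<theta>s + \<epsilon> \<omega>) \<partial>M)))"
  unfolding divergence_formula_def[symmetric]
proof (intro conjI allI impI; (elim conjE)?)
  fix y
  have "\<exists>\<theta> \<xi>. qp_solution A B c d lam y \<theta> \<xi>"
  proof (cases "lam = 0")
    case True
    then obtain u where "u \<ge> 0" "- d = transpose A *v u" using assms(3) by blast
    with True show ?thesis using qp_solution_exists_zero[OF assms(2)] by blast
  next
    case False
    with assms(1) show ?thesis by (intro qp_solution_exists_pos assms(2)) simp
  qed
  moreover have "\<theta> = \<theta>'"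
    if "qp_solution A B c d lam y \<theta> \<xi>" "qp_solution A B c d lam y \<theta>' \<xi>'" for \<theta> \<theta>' \<xi> \<xi>'
    using qp_solution_nonexpansive[OF assms(1) that] by simp
  ultimately show "\<exists>!\<theta>. \<exists>\<xi>. qp_solution A B c d lam y \<theta> \<xi>" by blast
next
  fix \<theta>h :: "real^'n \<Rightarrow> real^'n" and \<xi>h :: "real^'n \<Rightarrow> real^'p" and I :: "real^'n \<Rightarrow> 'm set"
  assume sol: "\<forall>y. qp_solution A B c d lam y (\<theta>h y) (\<xi>h y)"
    and max: "\<forall>y. maximal_indep_rows A B (tight_rows A B c (\<theta>h y) (\<xi>h y)) (I y)"
  have lip: "norm (\<theta>h x - \<theta>h z) \<le> norm (x - z)" for x z
    using qp_solution_nonexpansive[OF assms(1)] sol by blast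
  have lipi: "\<bar>\<theta>h x $ i - \<theta>h z $ i\<bar> \<le> norm (x - z)" for x z i
    using component_le_norm_cart[of "\<theta>h x - \<theta>h z" i] lip[of x z] by simp
  have "1-lipschitz_on UNIV \<theta>h" using lip by (auto simp: lipschitz_on_def dist_norm)
  then have cont: "continuous_on UNIV \<theta>h" by (rule lipschitz_on_continuous_on)
  have AE: "AE y in lebesgue. \<theta>h differentiable (at y) \<and> divergence \<theta>h y = divergence_formula A B lam (I y)"
    using AE_solution_derivative[OF assms(1) _ _ cont] sol max by blast
  then show "AE y in lebesgue. divergence \<theta>h y = divergence_formula A B lam (I y)" by eventually_elim simp
  have diff: "AE y in lebesgue. \<theta>h differentiable (at y)" using AE by eventually_elim simp
  fix i
  have adiff: "almost_differentiable (\<lambda>y. \<theta>h y $ i)"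
    unfolding almost_differentiable_def using diff
    by eventually_elim (auto simp: differentiable_def intro: bounded_linear.has_derivative[OF bounded_linear_vec_nth])
  then show "almost_differentiable (\<lambda>y. \<theta>h y $ i)" .
  show "essentially_bounded (gradient (\<lambda>y. \<theta>h y $ i))"
    by (rule essentially_bounded_gradient[OF lipi adiff])
  fix M :: "'w measure" and \<epsilon> :: "'w \<Rightarrow> real^'n" and \<theta>s :: "real^'n" and \<sigma> :: real
  assume "prob_space M" "\<sigma> > 0"
    "distributed M lborel \<epsilon> (\<lambda>x. ennreal (isotropic_normal_density \<sigma> x))"
  note df = degrees_of_freedom_eq_expected_divergence[OF lip diff this]
  show "has_covariance M (\<lambda>\<omega>. \<theta>h (\<theta>s + \<epsilon> \<omega>) $ i) (\<lambda>\<omega>. (\<theta>s + \<epsilon> \<omega>) $ i)" by (rule df(1))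
  show "integrable M (\<lambda>\<omega>. divergence \<theta>h (\<theta>s + \<epsilon> \<omega>))" by (rule df(2))
  show "degrees_of_freedom M \<sigma> (\<lambda>\<omega>. \<theta>s + \<epsilon> \<omega>) \<theta>h = (\<integral>\<omega>. divergence \<theta>h (\<theta>s + \<epsilon> \<omega>) \<partial>M)"
    by (rule df(3))
qed

end
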